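(* Let $G=(V,E)$ be a hypergraph, $c$ a positive integer, and $\mathcal{T}\subseteq V$ a set of terminals. Then there is a subset $E'\subseteq E$ such that $|E'|=O(|\mathcal{T}|c^3)$ and the contracted hypergraph $G/(E-E')$ is $(\mathcal{T},c)$-equivalent to $G$.
   Context: A hypergraph $G=(V,E)$ has a finite vertex set $V$ and a finite multiset $E$ of nonempty subsets of $V$. For $X\subseteq V$, $\partial X$ is the multiset of hyperedges meeting both $X$ and $V\setminus X$. For disjoint $A,B\subseteq V$, an $(A,B)$-cut is a bipartition $(X,V\setminus X)$ with $A\subseteq X$, $B\subseteq V\setminus X$, of value $|\partial X|$; $\mathrm{mincut}_G(A,B)$ is the minimum value and $\mathrm{mincut}^c_G(A,B)=\min(\mathrm{mincut}_G(A,B),c)$. $G/F$ denotes the hypergraph obtained by contracting every hyperedge of $F$ (identifying its vertices into a single vertex and deleting it). A hypergraph $H=(V_H,E_H)$ is a contraction based $(\mathcal{T},c)$-sparsifier of $G$ if there is a surjective map $\pi:V\to V_H$ such that every hyperedge of $H$ equals $\pi(f)=\{\pi(v):v\in f\}$ for some $f\in E$, and for any two (disjoint) subsets $T_1,T_2\subseteq\mathcal{T}$, $\mathrm{mincut}^c_G(T_1,T_2)=\mathrm{mincut}^c_H(\pi(T_1),\pi(T_2))$. $H$ is $(\mathcal{T},c)$-equivalent to $G$ if moreover the terminals are not affected by the projection, i.e. $\pi(\mathcal{T})=\mathcal{T}$ (each terminal is mapped to itself). For $G/(E-E')$ the projection is the contraction map. Constants in $O(\cdot)$ are absolute.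
   Formalization: Many parallel hyperedges joining two terminals refute the claim that each terminal maps to itself; so cut preservation is proved always, and full equivalence only if O(|T|c^3) kept hyperedges can keep terminals distinct; mincut^c is c when terminal images overlap. *)

theory Defs
  imports Main "HOL-Library.Multiset" "HOL-Library.Extended_Nat"
begin

record 'a hypergraph =
  verts :: "'a set"
  hedges :: "'a set multiset"

definition wf_hypergraph :: "'a hypergraph \<Rightarrow> bool" where
  "wf_hypergraph G \<longleftrightarrow> finite (verts G) \<and> (\<forall>e \<in># hedges G. e \<noteq> {} \<and> e \<subseteq> verts G)"

definition boundary :: "'a hypergraph \<Rightarrow> 'a set \<Rightarrow> 'a set multiset" where
  "boundary G X = {#e \<in># hedges G. e \<inter> X \<noteq> {} \<and> e \<inter> (verts G - X) \<noteq> {}#}"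

text \<open>A bipartition is given by its first side; either side may be empty (needed already for
  cuts with an empty terminal set on one side).\<close>

definition cuts :: "'a hypergraph \<Rightarrow> 'a set \<Rightarrow> 'a set \<Rightarrow> 'a set set" where
  "cuts G A B = {X. X \<subseteq> verts G \<and> A \<subseteq> X \<and> B \<subseteq> verts G - X}"

text \<open>If \<open>A\<close> and \<open>B\<close> intersect, there is no cut, the infimum is \<open>\<infinity>\<close>, and the
  value truncated at \<open>c\<close> is \<open>c\<close>. This happens in a contraction when two terminals have been
  identified.\<close>

definition mincut :: "'a hypergraph \<Rightarrow> 'a set \<Rightarrow> 'a set \<Rightarrow> enat" where
  "mincut G A B = (INF X \<in> cuts G A B. enat (size (boundary G X)))"

definition mincut_upto :: "nat \<Rightarrow> 'a hypergraph \<Rightarrow> 'a set \<Rightarrow> 'a set \<Rightarrow> enat" where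
  "mincut_upto c G A B = min (mincut G A B) (enat c)"

text \<open>The vertices of a contraction are the blocks of identified vertices of \<open>G\<close>: two vertices
  are identified iff they are linked by a chain of hyperedges of \<open>F\<close>.\<close>

definition contraction_map :: "'a set multiset \<Rightarrow> 'a \<Rightarrow> 'a set" where
  "contraction_map F v = {(u, w). \<exists>f \<in># F. u \<in> f \<and> w \<in> f}\<^sup>* `` {v}"

definition contract :: "'a hypergraph \<Rightarrow> 'a set multiset \<Rightarrow> 'a set hypergraph" where
  "contract G F = \<lparr>verts = contraction_map F ` verts G,
     hedges = image_mset ((`) (contraction_map F)) (hedges G - F)\<rparr>"

definition contraction_sparsifier ::
  "('a \<Rightarrow> 'b) \<Rightarrow> 'a set \<Rightarrow> nat \<Rightarrow> 'a hypergraph \<Rightarrow> 'b hypergraph \<Rightarrow> bool" where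
  "contraction_sparsifier \<pi> T c G H \<longleftrightarrow>
     wf_hypergraph H \<and> \<pi> ` verts G = verts H \<and>
     (\<forall>h \<in># hedges H. \<exists>f \<in># hedges G. h = \<pi> ` f) \<and>
     (\<forall>T1 T2. T1 \<subseteq> T \<longrightarrow> T2 \<subseteq> T \<longrightarrow> T1 \<inter> T2 = {} \<longrightarrow>
        mincut_upto c G T1 T2 = mincut_upto c H (\<pi> ` T1) (\<pi> ` T2))"

text \<open>The vertices of \<open>H\<close> can be renamed so that every terminal is mapped to itself iff the
  projection is injective on the terminals.\<close>

definition terminal_equivalent ::
  "('a \<Rightarrow> 'b) \<Rightarrow> 'a set \<Rightarrow> nat \<Rightarrow> 'a hypergraph \<Rightarrow> 'b hypergraph \<Rightarrow> bool" where
  "terminal_equivalent \<pi> T c G H \<longleftrightarrow> contraction_sparsifier \<pi> T c G H \<and> inj_on \<pi> T"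

text \<open>A bound on the number of kept hyperedges in terms of \<open>|T|\<close> and \<open>c\<close> alone
  cannot keep the terminals distinct: many parallel hyperedges may join two terminals, and
  contracting any one of them identifies the two. So the injectivity in
  \<^const>\<open>terminal_equivalent\<close> can only be asserted when the terminals can be kept distinct
  with that many hyperedges.\<close>

lemma no_bounded_terminal_equivalent_contraction:
  fixes C :: nat
  shows "\<exists>(G :: nat hypergraph) T c. wf_hypergraph G \<and> T \<subseteq> verts G \<and> 0 < c \<and>
    (\<forall>E'. E' \<subseteq># hedges G \<and> size E' \<le> C * card T * c ^ 3 \<longrightarrow>
      \<not> terminal_equivalent (contraction_map (hedges G - E')) T c G
          (contract G (hedges G - E')))"
proof -
  define V where "V = {0, 1 :: nat}"
  define E where "E = replicate_mset (2 * C + 1) V"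
  define G where "G = \<lparr>verts = V, hedges = E\<rparr>"
  have card: "card V = 2" by (simp add: V_def)
  have wf: "wf_hypergraph G"
    by (simp add: wf_hypergraph_def G_def E_def) (simp add: V_def)
  have not_inj: "\<not> inj_on (contraction_map (E - E')) V"
    if sub: "E' \<subseteq># E" and sz: "size E' \<le> C * card V * 1 ^ 3" for E'
  proof -
    have "size (E - E') = 2 * C + 1 - size E'"
      using size_Diff_submset[OF sub] by (simp add: E_def)
    then have "size (E - E') \<noteq> 0"
      using sz card by simp
    then obtain e where e: "e \<in># E - E'"
      by (metis multiset_nonemptyE size_empty)
    then have "e = V"
      by (metis E_def in_diffD in_replicate_mset)
    with e have mem: "V \<in># E - E'" by simp
    define R where "R = {(u, w). \<exists>f \<in># E - E'. u \<in> f \<and> w \<in> f}"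
    have R: "(0, 1) \<in> R" "(1, 0) \<in> R"
      unfolding R_def using mem by (auto simp: V_def intro!: bexI[of _ V])
    have "R\<^sup>* `` {0} = R\<^sup>* `` {1}"
      using R by (auto intro: converse_rtrancl_into_rtrancl)
    then have "contraction_map (E - E') 0 = contraction_map (E - E') 1"
      by (simp add: contraction_map_def R_def)
    then show ?thesis
      by (auto simp: inj_on_def V_def)
  qed
  show ?thesis
  proof (intro exI conjI allI impI)
    show "wf_hypergraph G" by (rule wf)
    show "V \<subseteq> verts G" by (simp add: G_def)
    show "0 < (1 :: nat)" by simp
    fix E' assume "E' \<subseteq># hedges G \<and> size E' \<le> C * card V * 1 ^ 3"
    then show "\<not> terminal_equivalent (contraction_map (hedges G - E')) V 1 G
        (contract G (hedges G - E'))"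
      using not_inj[of E'] by (simp add: terminal_equivalent_def G_def)
  qed
qed

end

theory Submission
  imports Defs "HOL-Computational_Algebra.Polynomial" "Jordan_Normal_Form.Determinant"
begin

text \<open>The cuts of \<open>G/F\<close> are the cuts of \<open>G\<close> that cut no hyperedge of \<open>F\<close>. Contract as many hyperedges
  as possible. Then every remaining hyperedge is essential: for some bipartition of the terminals with
  minimum cut value less than \<open>c\<close>, it belongs to all minimum cuts. It remains to bound the number
  of essential hyperedges.

  Attach \<open>4c\<close> pendant hyperedges to every terminal, and call a hyperedge that meets \<open>U \<subseteq> V\<close> a port of
  \<open>U\<close> if it is pendant or leaves \<open>U\<close>. Split \<open>V\<close> recursively along cuts of fewer than \<open>c\<close> hyperedges
  as long as both parts have at least \<open>4c\<close> ports; by a potential argument, the parts at the end have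
  \<open>O(|T|c)\<close> ports in total. In such a part \<open>U\<close>, regard hyperedges as nodes that are
  adjacent if they share a vertex of \<open>U\<close>; cuts become vertex separators, essential hyperedges
  remain essential, and one side of each relevant separator contains fewer than \<open>4c\<close> ports.

  Essential nodes are counted in the manner of Kratsch and Wahlstroem. Each node \<open>u\<close> receives the
  tensor product of three vectors: two come from generic linear systems on the graph, in
  dimensions \<open>O(|ports|)\<close> and \<open>O(c)\<close>, and one is a moment vector in dimension \<open>c\<close>. The separator
  of an essential node \<open>v\<close> defines a functional that is nonzero on \<open>v\<close> and vanishes on
  all other essential nodes, so their number is at most the dimension \<open>O(|ports| c\<^sup>2)\<close>. The small
  dimension \<open>O(c)\<close> suffices for the functionals supported on the large side because only the few ports
  on the small side constrain them.\<close>

section \<open>Generic matrices and matchings\<close>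

text \<open>Gaussian elimination: equation \<open>k\<close> is solved for a pivot \<open>p\<close>
  with \<open>g p k \<noteq> 0\<close> and substituted into the others, which leaves one equation
  and one unknown fewer.\<close>

lemma homogeneous_system_nontrivial_solution:
  fixes g :: "'s \<Rightarrow> 'j \<Rightarrow> real"
  assumes "finite J" "finite S" "card J < card S"
  shows "\<exists>l. (\<exists>s\<in>S. l s \<noteq> 0) \<and> (\<forall>j\<in>J. (\<Sum>s\<in>S. l s * g s j) = 0)"
  using assms
proof (induction J arbitrary: S g rule: finite_induct)
  case empty
  then have "S \<noteq> {}" by auto
  then show ?case by (intro exI[of _ "\<lambda>_. 1"]) auto
next
  case (insert k J)
  show ?case
  proof (cases "\<forall>s\<in>S. g s k = 0")
    case True
    have "card J < card S" using insert by simp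
    with insert.IH[OF insert.prems(1) this, of g] True show ?thesis
      by auto
  next
    case False
    then obtain p where p: "p \<in> S" "g p k \<noteq> 0" by blast
    define S' where "S' = S - {p}"
    have fin: "finite S'" and S: "S = insert p S'" "p \<notin> S'"
      using insert.prems p by (auto simp: S'_def)
    have "card J < card S'"
      using insert.prems insert.hyps S fin by simp
    from insert.IH[OF fin this, of "\<lambda>s j. g s j - g s k / g p k * g p j"]
    obtain l s0 where l: "s0 \<in> S'" "l s0 \<noteq> 0"
      "\<And>j. j \<in> J \<Longrightarrow> (\<Sum>s\<in>S'. l s * (g s j - g s k / g p k * g p j)) = 0"
      by blast
    define q where "q = - (\<Sum>s\<in>S'. l s * g s k) / g p k"
    have eq: "(\<Sum>s\<in>S. (l(p := q)) s * g s j) = q * g p j + (\<Sum>s\<in>S'. l s * g s j)" for j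
      using S fin by (auto intro!: sum.cong)
    have elim: "(\<Sum>s\<in>S'. l s * (g s j - g s k / g p k * g p j))
      = q * g p j + (\<Sum>s\<in>S'. l s * g s j)" for j
      by (simp add: q_def algebra_simps sum_subtractf sum_distrib_left sum_divide_distrib)
    have "(\<Sum>s\<in>S. (l(p := q)) s * g s j) = 0" if "j \<in> insert k J" for j
    proof (cases "j = k")
      case True
      then show ?thesis using p unfolding eq by (simp add: q_def)
    next
      case False
      then show ?thesis using that l(3)[of j] unfolding eq elim by simp
    qed
    moreover have "(l(p := q)) s0 \<noteq> 0" "s0 \<in> S" using l S by auto
    ultimately show ?thesis by blast
  qed
qed

text \<open>The vectors \<open>g u\<close> are linearly independent, since pairing a dependence with
  \<open>r v\<close> leaves only the coefficient of \<open>g v\<close>.\<close>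

lemma card_le_if_diagonal_factorization:
  fixes r :: "'s \<Rightarrow> 'j \<Rightarrow> real"
  assumes fin: "finite J" "finite S"
    and diag: "\<And>v. v \<in> S \<Longrightarrow> (\<Sum>j\<in>J. r v j * g v j) \<noteq> 0"
    and off: "\<And>v u. v \<in> S \<Longrightarrow> u \<in> S \<Longrightarrow> u \<noteq> v \<Longrightarrow> (\<Sum>j\<in>J. r v j * g u j) = 0"
  shows "card S \<le> card J"
proof (rule ccontr)
  assume "\<not> card S \<le> card J"
  then obtain l v where l: "v \<in> S" "l v \<noteq> 0" "\<And>j. j \<in> J \<Longrightarrow> (\<Sum>s\<in>S. l s * g s j) = 0"
    using homogeneous_system_nontrivial_solution[OF fin, of g] by (metis not_le)
  have "0 = (\<Sum>j\<in>J. r v j * (\<Sum>s\<in>S. l s * g s j))"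
    using l(3) by simp
  also have "\<dots> = (\<Sum>s\<in>S. l s * (\<Sum>j\<in>J. r v j * g s j))"
    unfolding sum_distrib_left by (subst sum.swap) (simp add: mult_ac)
  also have "\<dots> = l v * (\<Sum>j\<in>J. r v j * g v j)"
    using l(1) off[OF l(1)] fin(2) by (subst sum.remove[of _ v]) auto
  finally show False using l diag by simp
qed

text \<open>A substitute for being a polynomial in the matrix entries: restrictions to lines are all
  it takes to avoid finitely many zero sets.\<close>

definition polynomial_on_lines :: "(('r \<Rightarrow> 'k \<Rightarrow> real) \<Rightarrow> real) \<Rightarrow> bool" where
  "polynomial_on_lines P \<longleftrightarrow>
    (\<forall>a b. \<exists>p :: real poly. \<forall>t. P (\<lambda>i j. a i j + t * (b i j - a i j)) = poly p t)"

lemma polynomial_on_lines_const: "polynomial_on_lines (\<lambda>_. x)"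
  unfolding polynomial_on_lines_def
  by (intro allI exI[of _ "[:x:]"]) simp

lemma polynomial_on_lines_entry: "polynomial_on_lines (\<lambda>a. a i j)"
proof -
  have "\<exists>p :: real poly. \<forall>t. a i j + t * (b i j - a i j) = poly p t" for a b :: "'a \<Rightarrow> 'b \<Rightarrow> real"
    by (intro exI[of _ "[:a i j, b i j - a i j:]"]) simp
  then show ?thesis
    unfolding polynomial_on_lines_def by blast
qed

lemma polynomial_on_lines_add:
  assumes "polynomial_on_lines P" "polynomial_on_lines Q"
  shows "polynomial_on_lines (\<lambda>a. P a + Q a)"
  using assms unfolding polynomial_on_lines_def by (metis poly_add)

lemma polynomial_on_lines_mult:
  assumes "polynomial_on_lines P" "polynomial_on_lines Q"
  shows "polynomial_on_lines (\<lambda>a. P a * Q a)"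
  using assms unfolding polynomial_on_lines_def by (metis poly_mult)

lemma polynomial_on_lines_sum:
  "(\<And>i. i \<in> I \<Longrightarrow> polynomial_on_lines (P i)) \<Longrightarrow> polynomial_on_lines (\<lambda>a. \<Sum>i\<in>I. P i a)"
  by (induction I rule: infinite_finite_induct)
    (auto intro: polynomial_on_lines_const polynomial_on_lines_add)

lemma polynomial_on_lines_prod:
  "(\<And>i. i \<in> I \<Longrightarrow> polynomial_on_lines (P i)) \<Longrightarrow> polynomial_on_lines (\<lambda>a. \<Prod>i\<in>I. P i a)"
  by (induction I rule: infinite_finite_induct)
    (auto intro: polynomial_on_lines_const polynomial_on_lines_mult)

text \<open>A line joins a point where the product of the earlier functions is nonzero to one where
  \<open>P\<close> is. Both restrictions are nonzero polynomials in one variable, so some parameter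
  avoids their finitely many roots.\<close>

lemma common_nonzero_point:
  assumes "finite K"
    and "\<And>P. P \<in> K \<Longrightarrow> polynomial_on_lines P"
    and "\<And>P. P \<in> K \<Longrightarrow> \<exists>a. P a \<noteq> 0"
  shows "\<exists>a. \<forall>P\<in>K. P a \<noteq> 0"
proof -
  have "\<exists>a. (\<Prod>P\<in>K. P a) \<noteq> 0"
    using assms
  proof (induction K rule: finite_induct)
    case (insert P K)
    from insert obtain a where a: "(\<Prod>P\<in>K. P a) \<noteq> 0" by blast
    from insert obtain b where b: "P b \<noteq> 0" by blast
    let ?l = "\<lambda>t i j. a i j + t * (b i j - a i j)"
    have "polynomial_on_lines (\<lambda>a. \<Prod>P\<in>K. P a)"
      using insert by (intro polynomial_on_lines_prod) auto
    then obtain p where p: "\<And>t. (\<Prod>P\<in>K. P (?l t)) = poly p t"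
      unfolding polynomial_on_lines_def by blast
    have "polynomial_on_lines P" using insert by auto
    then obtain q where q: "\<And>t. P (?l t) = poly q t"
      unfolding polynomial_on_lines_def by blast
    have "p \<noteq> 0" using p[of 0] a by auto
    moreover have "q \<noteq> 0" using q[of 1] b by auto
    ultimately have "finite {t. poly (p * q) t = 0}"
      by (intro poly_roots_finite) simp
    then obtain t where "poly (p * q) t \<noteq> 0"
      by (metis (mono_tags, lifting) ex_new_if_finite infinite_UNIV_char_0 mem_Collect_eq)
    then have "(\<Prod>P\<in>insert P K. P (?l t)) \<noteq> 0"
      using insert.hyps p[of t] q[of t] by simp
    then show ?case by blast
  qed simp
  with assms(1) show ?thesis by auto
qed

text \<open>The determinant is polynomial in the entries \<open>a\<close>. It is not identically
  zero because the support pattern \<open>K\<close> contains the matching \<open>f\<close>, whose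
  indicator matrix is the identity once columns are indexed through \<open>f\<close>.\<close>

lemma generic_square_matrix_invertible:
  fixes K :: "'r \<Rightarrow> 'k \<Rightarrow> bool"
  assumes R: "finite R" and f: "inj_on f R" and K: "\<And>i. i \<in> R \<Longrightarrow> K i (f i)"
  shows "\<exists>P. polynomial_on_lines P \<and> (\<exists>a. P a \<noteq> 0) \<and>
    (\<forall>a. P a \<noteq> 0 \<longrightarrow> (\<exists>B. \<forall>i\<in>R. \<forall>k\<in>R.
      (\<Sum>j\<in>R. of_bool (K i (f j)) * a i (f j) * B j k) = of_bool (i = k) \<and>
      (\<Sum>j\<in>R. B i j * (of_bool (K j (f k)) * a j (f k))) = of_bool (i = k)))"
proof -
  obtain e where e: "bij_betw e {0..<card R} R"
    using ex_bij_betw_nat_finite[OF R] by blast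
  define n where "n = card R"
  have e: "bij_betw e {0..<n} R" using e by (simp add: n_def)
  have eR: "e i \<in> R" if "i < n" for i using e that by (auto simp: bij_betw_def)
  have e_eq: "e i = e j \<longleftrightarrow> i = j" if "i < n" "j < n" for i j
    using e that by (auto simp: bij_betw_def inj_on_def)
  define m where "m a i j = of_bool (K i (f j)) * a i (f j)" for a :: "'r \<Rightarrow> 'k \<Rightarrow> real" and i j
  define A where "A a = mat n n (\<lambda>(i, j). m a (e i) (e j))" for a
  define P where "P a = det (A a)" for a
  have A: "A a \<in> carrier_mat n n" for a by (simp add: A_def)
  have P_eq: "P = (\<lambda>a. \<Sum>p\<in>{p. p permutes {0..<n}}. signof p * (\<Prod>i = 0..<n. A a $$ (i, p i)))"
    unfolding P_def det_def'[OF A] ..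
  have "polynomial_on_lines P"
    unfolding P_eq
  proof (intro polynomial_on_lines_sum polynomial_on_lines_mult polynomial_on_lines_const
      polynomial_on_lines_prod)
    fix p i assume "p \<in> {p. p permutes {0..<n}}" "i \<in> {0..<n}"
    then have "(\<lambda>a. A a $$ (i, p i)) = (\<lambda>a. m a (e i) (e (p i)))"
      using permutes_in_image[of p "{0..<n}" i] by (auto simp: A_def)
    then show "polynomial_on_lines (\<lambda>a. A a $$ (i, p i))"
      unfolding m_def
      by (simp add: polynomial_on_lines_mult polynomial_on_lines_const polynomial_on_lines_entry)
  qed
  moreover have "\<exists>a. P a \<noteq> 0"
  proof -
    define a where "a i c = (of_bool (c = f i) :: real)" for i c
    have "A a = 1\<^sub>m n"
    proof (rule eq_matI)
      fix i j assume "i < dim_row (1\<^sub>m n :: real mat)" "j < dim_col (1\<^sub>m n :: real mat)"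
      then have ij: "i < n" "j < n" by auto
      have "f (e j) = f (e i) \<longleftrightarrow> i = j"
        using inj_onD[OF f _ eR eR, of j i] e_eq ij by auto
      then show "A a $$ (i, j) = 1\<^sub>m n $$ (i, j)"
        using ij K[OF eR] by (auto simp: A_def m_def a_def)
    qed (auto simp: A_def)
    then show ?thesis by (intro exI[of _ a]) (simp add: P_def)
  qed
  moreover have "\<exists>B. \<forall>i\<in>R. \<forall>k\<in>R. (\<Sum>j\<in>R. m a i j * B j k) = of_bool (i = k) \<and>
      (\<Sum>j\<in>R. B i j * m a j k) = of_bool (i = k)" if "P a \<noteq> 0" for a
  proof -
    from det_non_zero_imp_unit[OF A that[unfolded P_def]]
    obtain B where B: "B \<in> carrier_mat n n" "B * A a = 1\<^sub>m n" "A a * B = 1\<^sub>m n"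
      unfolding Units_def ring_mat_def by auto
    define g where "g = inv_into {0..<n} e"
    have ge: "g (e i) = i" if "i < n" for i
      using e that by (simp add: g_def bij_betw_def inv_into_f_f)
    have reindex: "(\<Sum>j\<in>R. h j) = (\<Sum>j = 0..<n. h (e j))" for h :: "'r \<Rightarrow> real"
      using sum.reindex_bij_betw[OF e, of h] by simp
    have "(\<Sum>j\<in>R. m a i j * B $$ (g j, g k)) = of_bool (i = k) \<and>
      (\<Sum>j\<in>R. B $$ (g i, g j) * m a j k) = of_bool (i = k)" if ik: "i \<in> R" "k \<in> R" for i k
    proof -
      obtain i' k' where i': "i' < n" "i = e i'" and k': "k' < n" "k = e k'"
        using e ik by (auto simp: bij_betw_def image_iff)
      have "(A a * B) $$ (i', k') = of_bool (i' = k')" "(B * A a) $$ (i', k') = of_bool (i' = k')"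
        using B(2,3) i' k' by auto
      then show ?thesis
        using i' k' A[of a] B(1) e_eq
        by (auto simp: reindex ge scalar_prod_def A_def)
    qed
    then show ?thesis by (intro exI[of _ "\<lambda>j k. B $$ (g j, g k)"]) blast
  qed
  ultimately show ?thesis
    unfolding m_def by blast
qed

text \<open>Induction on \<open>card R\<close>. If a proper nonempty \<open>U\<close> has no surplus
  of neighbours, \<open>U\<close> and \<open>R - U\<close> are matched separately, the latter
  avoiding the neighbours of \<open>U\<close>. Otherwise every proper nonempty subset has a
  neighbour to spare, so any first choice is harmless.\<close>

lemma hall_marriage:
  assumes "finite R" "\<And>r. r \<in> R \<Longrightarrow> finite (N r)"
    and "\<And>R'. R' \<subseteq> R \<Longrightarrow> card R' \<le> card (\<Union>r\<in>R'. N r)"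
  shows "\<exists>f. inj_on f R \<and> (\<forall>r\<in>R. f r \<in> N r)"
  using assms
proof (induction "card R" arbitrary: R N rule: less_induct)
  case less
  show ?case
  proof (cases "R = {}")
    case True then show ?thesis by auto
  next
    case False
    show ?thesis
    proof (cases "\<exists>U. U \<subset> R \<and> U \<noteq> {} \<and> card (\<Union>r\<in>U. N r) \<le> card U")
      case True
      then obtain U where U: "U \<subset> R" "U \<noteq> {}" "card (\<Union>r\<in>U. N r) \<le> card U" by blast
      have finU: "finite U" using U less.prems(1) by (auto intro: finite_subset)
      define M where "M = (\<Union>r\<in>U. N r)"
      have finM: "finite M" using finU U less.prems(2) by (auto simp: M_def)
      have "card U < card R" using U less.prems(1) by (auto intro: psubset_card_mono)
      then obtain f where f: "inj_on f U" "\<And>r. r \<in> U \<Longrightarrow> f r \<in> N r"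
        using less.hyps[of U N] U less.prems finU by (metis psubsetE subset_eq)
      have "\<exists>g. inj_on g (R - U) \<and> (\<forall>r\<in>R - U. g r \<in> N r - M)"
      proof (rule less.hyps)
        show "card (R - U) < card R"
          using U less.prems(1) by (intro psubset_card_mono) auto
        show "finite (R - U)" "\<And>r. r \<in> R - U \<Longrightarrow> finite (N r - M)"
          using less.prems by auto
        fix R' assume R': "R' \<subseteq> R - U"
        have fin: "finite R'" using R' less.prems(1) by (auto intro: finite_subset)
        have "card R' + card U = card (R' \<union> U)"
          using fin finU R' by (subst card_Un_disjoint) auto
        also have "\<dots> \<le> card (\<Union>r\<in>R' \<union> U. N r)"
          using R' U by (intro less.prems(3)) auto
        also have "(\<Union>r\<in>R' \<union> U. N r) = (\<Union>r\<in>R'. N r - M) \<union> M"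
          by (auto simp: M_def)
        also have "card \<dots> \<le> card (\<Union>r\<in>R'. N r - M) + card M"
          by (rule card_Un_le)
        finally show "card R' \<le> card (\<Union>r\<in>R'. N r - M)"
          using U(3) by (simp add: M_def)
      qed
      then obtain g where g: "inj_on g (R - U)" "\<And>r. r \<in> R - U \<Longrightarrow> g r \<in> N r - M" by blast
      define h where "h r = (if r \<in> U then f r else g r)" for r
      have "inj_on h R"
      proof (rule inj_onI)
        fix x y assume xy: "x \<in> R" "y \<in> R" "h x = h y"
        have "h r \<in> M \<longleftrightarrow> r \<in> U" if "r \<in> R" for r
          using f(2)[of r] g(2)[of r] that by (auto simp: h_def M_def)
        then have "x \<in> U \<longleftrightarrow> y \<in> U" using xy by metis
        then show "x = y"
          using xy f(1) g(1) by (auto simp: h_def inj_on_def split: if_splits)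
      qed
      moreover have "\<forall>r\<in>R. h r \<in> N r" using f(2) g(2) by (auto simp: h_def)
      ultimately show ?thesis by blast
    next
      case False
      with \<open>R \<noteq> {}\<close> obtain r where r: "r \<in> R" by blast
      have "card {r} \<le> card (\<Union>s\<in>{r}. N s)" using r by (intro less.prems(3)) auto
      then obtain y where y: "y \<in> N r" by fastforce
      have "\<exists>g. inj_on g (R - {r}) \<and> (\<forall>s\<in>R - {r}. g s \<in> N s - {y})"
      proof (rule less.hyps)
        show "card (R - {r}) < card R"
          using r less.prems(1) by (intro psubset_card_mono) auto
        show "finite (R - {r})" "\<And>s. s \<in> R - {r} \<Longrightarrow> finite (N s - {y})"
          using less.prems by auto
        fix R' assume R': "R' \<subseteq> R - {r}"
        show "card R' \<le> card (\<Union>s\<in>R'. N s - {y})"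
        proof (cases "R' = {}")
          case nonempty: False
          have "R' \<subset> R" using R' r by auto
          then have "card R' < card (\<Union>s\<in>R'. N s)"
            using False nonempty by (meson not_le)
          also have "(\<Union>s\<in>R'. N s - {y}) = (\<Union>s\<in>R'. N s) - {y}" by auto
          then have "card (\<Union>s\<in>R'. N s) \<le> Suc (card (\<Union>s\<in>R'. N s - {y}))"
            by (metis card_Diff_singleton_if diff_Suc_1 le_SucI order_refl Suc_pred not_gr_zero le0)
          finally show ?thesis by simp
        qed simp
      qed
      then obtain g where g: "inj_on g (R - {r})" "\<And>s. s \<in> R - {r} \<Longrightarrow> g s \<in> N s - {y}" by blast
      have "inj_on (g(r := y)) R"
      proof (rule inj_onI)
        fix a b assume ab: "a \<in> R" "b \<in> R" "(g(r := y)) a = (g(r := y)) b"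
        show "a = b"
          using ab g(2)[of a] g(2)[of b] inj_onD[OF g(1), of a b]
          by (auto split: if_splits)
      qed
      moreover have "\<forall>s\<in>R. (g(r := y)) s \<in> N s" using g(2) y by auto
      ultimately show ?thesis by blast
    qed
  qed
qed

text \<open>A configuration \<open>(v, C, Z)\<close> consists of a separator \<open>C\<close>, one of its sides \<open>Z\<close> and a node
  \<open>v\<close> of \<open>C\<close>. Consider functions \<open>x\<close> on the nodes that satisfy one generic linear equation per node,
  relating the values at its neighbours; the equations of the nodes in \<open>Q\<close> have a right-hand side
  that depends generically on \<open>r \<in> \<real>\<^sup>D\<close>. Then \<open>x\<close> is determined by \<open>r\<close>, and \<open>h u\<close> expresses a second
  generic combination of the values at the neighbours of \<open>u\<close> through \<open>r\<close>. If \<open>x\<close> is supported on \<open>Z\<close>,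
  this combination vanishes beyond \<open>C\<close>. By Hall's theorem some such \<open>x\<close> makes it nonzero at \<open>v\<close>.\<close>

lemma generic_separating_vectors:
  fixes adj :: "'n \<Rightarrow> 'n \<Rightarrow> bool" and Cfg :: "('n \<times> 'n set \<times> 'n set) set"
  assumes finN: "finite N" and refl: "\<And>u. u \<in> N \<Longrightarrow> adj u u" and Q: "Q \<subseteq> N"
    and finCfg: "finite Cfg"
    and sub: "\<And>v C Z. (v, C, Z) \<in> Cfg \<Longrightarrow> C \<subseteq> N \<and> Z \<subseteq> N \<and> v \<in> C"
    and closed: "\<And>v C Z u w. (v, C, Z) \<in> Cfg \<Longrightarrow> w \<in> Z \<Longrightarrow> u \<in> N \<Longrightarrow> adj u w \<Longrightarrow> u \<in> Z \<union> C"
    and D: "\<And>v C Z. (v, C, Z) \<in> Cfg \<Longrightarrow> card (Q - C - Z) + card C < D"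
    and hall0: "\<And>v C Z R. (v, C, Z) \<in> Cfg \<Longrightarrow> R \<subseteq> C \<union> Z - Q \<Longrightarrow>
      card R \<le> card {z \<in> Z. \<exists>u\<in>R. adj u z}"
    and hall1: "\<And>v C Z R. (v, C, Z) \<in> Cfg \<Longrightarrow> R \<subseteq> C \<union> Z - Q \<Longrightarrow>
      card R < card {z \<in> Z. \<exists>u\<in>insert v R. adj u z}"
  shows "\<exists>h :: 'n \<Rightarrow> nat \<Rightarrow> real. \<forall>(v, C, Z)\<in>Cfg. \<exists>r.
    (\<Sum>d<D. r d * h v d) \<noteq> 0 \<and> (\<forall>u\<in>N - C - Z. (\<Sum>d<D. r d * h u d) = 0)"
proof -
  \<comment> \<open>\<open>Inl u\<close> is the equation of \<open>u\<close> and \<open>Inr u\<close> its second combination; the columns are the nodes and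
    the coordinates of \<open>r\<close>.\<close>
  define K :: "'n + 'n \<Rightarrow> 'n + nat \<Rightarrow> bool" where
    "K i c = (case i of
        Inl u \<Rightarrow> (case c of Inl w \<Rightarrow> adj u w | Inr d \<Rightarrow> u \<in> Q)
      | Inr v \<Rightarrow> (case c of Inl w \<Rightarrow> adj v w | Inr d \<Rightarrow> False))" for i c
  have K_simps: "K (Inl u) (Inl w) = adj u w" "K (Inl u) (Inr d) = (u \<in> Q)"
    "K (Inr u) (Inl w) = adj u w" "K (Inr u) (Inr d) = False" for u w d
    by (simp_all add: K_def)
  define m :: "('n + 'n \<Rightarrow> 'n + nat \<Rightarrow> real) \<Rightarrow> 'n + 'n \<Rightarrow> 'n + nat \<Rightarrow> real" where
    "m a i c = of_bool (K i c) * a i c" for a i c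
  \<comment> \<open>The unknowns are \<open>x\<close> on \<open>Z\<close> and the coordinates of
    \<open>r\<close>. The equations of nodes outside \<open>C \<union> Z \<union> Q\<close> involve
    none of them and hold automatically.\<close>
  define Rows where "Rows = (\<lambda>(v, C, Z). insert (Inr v) (Inl ` (C \<union> Z \<union> Q)) :: ('n + 'n) set)"
  define Cols where "Cols = (\<lambda>(v :: 'n, C :: 'n set, Z). Inl ` Z \<union> Inr ` {..<D} :: ('n + nat) set)"
  let ?inv = "\<lambda>R f a B. \<forall>i\<in>R. \<forall>k\<in>R.
      (\<Sum>j\<in>R. m a i (f j) * B j k) = of_bool (i = k) \<and>
      (\<Sum>j\<in>R. B i j * m a j (f k)) = of_bool (i = k)"
  have finRows: "finite (Rows k)" and finCols: "finite (Cols k)" if k: "k \<in> Cfg" for k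
  proof -
    obtain v C Z where k_eq: "k = (v, C, Z)" by (cases k)
    have "finite C" "finite Z" "finite Q"
      using sub[of v C Z] k k_eq Q finN by (auto intro: finite_subset)
    then show "finite (Rows k)" "finite (Cols k)"
      by (auto simp: Rows_def Cols_def k_eq)
  qed
  have "\<exists>f. inj_on f (Rows k) \<and> (\<forall>i\<in>Rows k. f i \<in> {c \<in> Cols k. K i c})" if k: "k \<in> Cfg" for k
  proof (rule hall_marriage)
    show "finite (Rows k)" using k by (rule finRows)
    show "finite {c \<in> Cols k. K i c}" for i using finCols[OF k] by simp
    obtain v C Z where k_eq: "k = (v, C, Z)" by (cases k)
    have cfg: "(v, C, Z) \<in> Cfg" using k k_eq by simp
    have fin: "finite C" "finite Z" "finite Q" "C \<subseteq> N" "Z \<subseteq> N"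
      using sub[OF cfg] Q finN by (auto intro: finite_subset)
    fix R' assume R': "R' \<subseteq> Rows k"
    define R0 where "R0 = Inl -` R'"
    have R0: "R0 \<subseteq> C \<union> Z \<union> Q"
      using R' by (auto simp: R0_def Rows_def k_eq)
    then have finR0: "finite R0" using fin by (auto intro: finite_subset)
    have R'_eq: "R' = Inl ` R0 \<union> R' \<inter> {Inr v}"
      using R' by (auto simp: R0_def Rows_def k_eq)
    have cardR': "card R' = card R0 + card (R' \<inter> {Inr v})"
      by (subst R'_eq, subst card_Un_disjoint) (use finR0 in \<open>auto simp: card_image\<close>)
    define U where "U = (\<Union>i\<in>R'. {c \<in> Cols k. K i c})"
    have finU: "finite U"
      by (rule finite_subset[OF _ finCols[OF k]]) (auto simp: U_def)
    show "card R' \<le> card (\<Union>i\<in>R'. {c \<in> Cols k. K i c})"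
    proof (cases "R0 \<inter> Q = {}")
      case False
      then obtain q where q: "q \<in> R0" "q \<in> Q" by blast
      \<comment> \<open>An equation of a node in \<open>Q\<close> has all \<open>D\<close> columns
        of \<open>r\<close>, and each node of \<open>R0 \<inter> Z\<close> has its own column. The
        slack in \<open>D\<close> pays for the rows from \<open>C\<close> and
        \<open>Q - C - Z\<close> and for \<open>Inr v\<close>.\<close>
      have "Inl ` (R0 \<inter> Z) \<union> Inr ` {..<D} \<subseteq> U"
      proof (intro Un_least subsetI)
        fix c :: "'n + nat" assume "c \<in> Inl ` (R0 \<inter> Z)"
        then obtain w where w: "c = Inl w" "w \<in> Z" "Inl w \<in> R'" by (auto simp: R0_def)
        moreover have "K (Inl w) (Inl w)" using w(2) refl fin(5) by (auto simp: K_simps)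
        ultimately show "c \<in> U" by (auto simp: U_def Cols_def k_eq)
      next
        fix c :: "'n + nat" assume "c \<in> Inr ` {..<D}"
        moreover have "Inl q \<in> R'" "K (Inl q) c"
          using q \<open>c \<in> Inr ` {..<D}\<close> by (auto simp: R0_def K_simps)
        ultimately show "c \<in> U" by (auto simp: U_def Cols_def k_eq)
      qed
      then have "card (Inl ` (R0 \<inter> Z) \<union> Inr ` {..<D} :: ('n + nat) set) \<le> card U"
        by (rule card_mono[OF finU])
      moreover have "card (Inl ` (R0 \<inter> Z) \<union> Inr ` {..<D} :: ('n + nat) set) = card (R0 \<inter> Z) + D"
        using finR0 by (subst card_Un_disjoint) (auto simp: card_image)
      moreover have "card R0 \<le> card ((R0 \<inter> Z) \<union> (C \<union> (Q - C - Z)))"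
        using R0 finR0 fin by (intro card_mono) auto
      moreover have "\<dots> \<le> card (R0 \<inter> Z) + card (C \<union> (Q - C - Z))"
        by (rule card_Un_le)
      moreover have "card (C \<union> (Q - C - Z)) \<le> card C + card (Q - C - Z)"
        by (rule card_Un_le)
      moreover have "card (R' \<inter> {Inr v}) \<le> 1"
        using card_mono[of "{Inr v}" "R' \<inter> {Inr v}"] by simp
      ultimately show ?thesis
        using cardR' D[OF cfg] unfolding U_def by linarith
    next
      case True
      then have R0': "R0 \<subseteq> C \<union> Z - Q" using R0 by auto
      \<comment> \<open>The rows \<open>Inl v\<close> and \<open>Inr v\<close> have the same
        neighbours in \<open>Z\<close>. If both occur, \<open>R1\<close> is just \<open>R0\<close>
        although one more row needs a column; the strict inequality in \<open>hall1\<close> provides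
        it.\<close>
      define R1 where "R1 = (if Inr v \<in> R' then insert v R0 else R0)"
      have "Inl ` {z \<in> Z. \<exists>u\<in>R1. adj u z} \<subseteq> U"
      proof clarify
        fix z u assume z: "z \<in> Z" and u: "u \<in> R1" "adj u z"
        have "Inl u \<in> R' \<or> Inr u \<in> R'" using u(1) by (auto simp: R1_def R0_def split: if_splits)
        then obtain i where "i \<in> R'" "K i (Inl z)" using u(2) K_simps by metis
        then show "Inl z \<in> U" using z by (auto simp: U_def Cols_def k_eq)
      qed
      then have "card (Inl ` {z \<in> Z. \<exists>u\<in>R1. adj u z} :: ('n + nat) set) \<le> card U"
        by (rule card_mono[OF finU])
      then have le: "card {z \<in> Z. \<exists>u\<in>R1. adj u z} \<le> card U"
        by (simp add: card_image)
      show ?thesis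
      proof (cases "Inr v \<in> R'")
        case True
        then have "R' \<inter> {Inr v} = {Inr v}" by auto
        then show ?thesis
          using hall1[OF cfg R0'] le True cardR' unfolding U_def R1_def by simp
      next
        case False
        then have "R' \<inter> {Inr v} = {}" by auto
        then show ?thesis
          using hall0[OF cfg R0'] le False cardR' unfolding U_def R1_def by simp
      qed
    qed
  qed
  then obtain f where f: "\<And>k. k \<in> Cfg \<Longrightarrow> inj_on (f k) (Rows k)"
    "\<And>k i. k \<in> Cfg \<Longrightarrow> i \<in> Rows k \<Longrightarrow> f k i \<in> Cols k \<and> K i (f k i)"
    by (metis (mono_tags, lifting) mem_Collect_eq)
  define generic where "generic R f P \<longleftrightarrow> polynomial_on_lines P \<and> (\<exists>a. P a \<noteq> 0) \<and>
    (\<forall>a. P a \<noteq> 0 \<longrightarrow> (\<exists>B. ?inv R f a B))" for R :: "('n + 'n) set" and f P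
  have "\<exists>P. generic (Rows k) (f k) P" if k: "k \<in> Cfg" for k
    unfolding generic_def m_def
  proof (rule generic_square_matrix_invertible[of "Rows k" "f k" K])
    show "finite (Rows k)" "inj_on (f k) (Rows k)" "\<And>i. i \<in> Rows k \<Longrightarrow> K i (f k i)"
      using finRows[OF k] f[OF k] by simp_all
  qed
  then obtain P where "\<And>k. k \<in> Cfg \<Longrightarrow> generic (Rows k) (f k) (P k)"
    by metis
  note P = this[unfolded generic_def]
  have "\<exists>P. generic (Inl ` N) (case_sum Inl Inl) P"
    unfolding generic_def m_def
    by (rule generic_square_matrix_invertible[of "Inl ` N" "case_sum Inl Inl" K])
      (use finN refl in \<open>auto simp: inj_on_def K_simps\<close>)
  then obtain P0 where "generic (Inl ` N) (case_sum Inl Inl) P0" ..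
  note P0 = this[unfolded generic_def]
  \<comment> \<open>A single \<open>a\<close> serves all configurations, so that \<open>h\<close>
    below depends on none of them.\<close>
  have "\<exists>a. \<forall>P\<in>insert P0 (P ` Cfg). P a \<noteq> 0"
    by (rule common_nonzero_point) (use finCfg P P0 in auto)
  then obtain a where a: "P0 a \<noteq> 0" "\<And>k. k \<in> Cfg \<Longrightarrow> P k a \<noteq> 0" by auto
  from P0 a(1) obtain B0 where B0: "?inv (Inl ` N) (case_sum Inl Inl) a B0" by blast
  \<comment> \<open>The coefficients that write the second combination of \<open>u\<close>, on the
    node columns, as a linear combination of the node equations.\<close>
  define l where "l u j = (\<Sum>i\<in>N. m a (Inr u) (Inl i) * B0 (Inl i) (Inl j))" for u j
  have l: "(\<Sum>j\<in>N. l u j * m a (Inl j) (Inl w)) = m a (Inr u) (Inl w)" if w: "w \<in> N" for u w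
  proof -
    have inv: "(\<Sum>j\<in>N. B0 (Inl i) (Inl j) * m a (Inl j) (Inl w)) = of_bool (i = w)" if "i \<in> N" for i
      using bspec[OF bspec[OF B0, of "Inl i"], of "Inl w"] that w
      by (simp add: sum.reindex)
    have "(\<Sum>j\<in>N. l u j * m a (Inl j) (Inl w))
      = (\<Sum>i\<in>N. m a (Inr u) (Inl i) * (\<Sum>j\<in>N. B0 (Inl i) (Inl j) * m a (Inl j) (Inl w)))"
      unfolding l_def sum_distrib_right sum_distrib_left
      by (subst sum.swap) (simp add: mult_ac)
    also have "\<dots> = (\<Sum>i\<in>N. m a (Inr u) (Inl i) * of_bool (i = w))"
      using inv by simp
    also have "\<dots> = m a (Inr u) (Inl w)"
      using finN w by (simp add: of_bool_def if_distrib cong: if_cong)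
    finally show ?thesis .
  qed
  define h where "h u d = (\<Sum>j\<in>N. l u j * m a (Inl j) (Inr d))" for u d
  have "\<exists>r. (\<Sum>d<D. r d * h v d) \<noteq> 0 \<and> (\<forall>u\<in>N - C - Z. (\<Sum>d<D. r d * h u d) = 0)"
    if cfg: "(v, C, Z) \<in> Cfg" for v C Z
  proof -
    let ?k = "(v, C, Z)"
    have CZ: "C \<subseteq> N" "Z \<subseteq> N" "v \<in> C" using sub[OF cfg] by auto
    have finZ: "finite Z" using CZ finN by (auto intro: finite_subset)
    from P[OF cfg] a(2)[OF cfg] obtain B where B: "?inv (Rows ?k) (f ?k) a B" by blast
    \<comment> \<open>The solution of the square system of this configuration with right-hand side 1
      at \<open>Inr v\<close> and 0 elsewhere. The matching carries rows to columns; unmatched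
      columns get the value 0.\<close>
    define x where "x c = (if c \<in> f ?k ` Rows ?k then B (inv_into (Rows ?k) (f ?k) c) (Inr v) else 0)" for c
    have row: "(\<Sum>c\<in>Cols ?k. m a i c * x c) = of_bool (i = Inr v)" if i: "i \<in> Rows ?k" for i
    proof -
      have "(\<Sum>c\<in>Cols ?k. m a i c * x c) = (\<Sum>c\<in>f ?k ` Rows ?k. m a i c * x c)"
        using f(2)[OF cfg] finCols[OF cfg]
        by (intro sum.mono_neutral_right) (auto simp: x_def)
      also have "\<dots> = (\<Sum>j\<in>Rows ?k. m a i (f ?k j) * B j (Inr v))"
        using f(1)[OF cfg] by (simp add: sum.reindex x_def)
      also have "\<dots> = of_bool (i = Inr v)"
        using bspec[OF bspec[OF B i], of "Inr v"] by (simp add: Rows_def)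
      finally show ?thesis .
    qed
    have split: "(\<Sum>c\<in>Cols ?k. m a i c * x c)
      = (\<Sum>w\<in>Z. m a i (Inl w) * x (Inl w)) + (\<Sum>d<D. m a i (Inr d) * x (Inr d))" for i
    proof -
      have "Inl ` Z \<inter> Inr ` {..<D} = ({} :: ('n + nat) set)" by auto
      then show ?thesis
        unfolding Cols_def using finZ by (simp add: sum.union_disjoint sum.reindex)
    qed
    have main: "(\<Sum>w\<in>Z. m a (Inl u) (Inl w) * x (Inl w)) = - (\<Sum>d<D. m a (Inl u) (Inr d) * x (Inr d))"
      if u: "u \<in> N" for u
    proof (cases "Inl u \<in> Rows ?k")
      case True
      then show ?thesis using row[OF True] split[of "Inl u"] by simp
    next
      case False
      then have "u \<notin> Z \<union> C" "u \<notin> Q" by (auto simp: Rows_def)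
      then have "m a (Inl u) (Inl w) = 0" if "w \<in> Z" for w
        using closed[OF cfg that u] by (auto simp: m_def K_simps)
      moreover have "m a (Inl u) (Inr d) = 0" for d
        using \<open>u \<notin> Q\<close> by (simp add: m_def K_simps)
      ultimately show ?thesis by simp
    qed
    have h: "(\<Sum>d<D. - x (Inr d) * h u d) = (\<Sum>w\<in>Z. m a (Inr u) (Inl w) * x (Inl w))" for u
    proof -
      have "(\<Sum>d<D. - x (Inr d) * h u d)
        = (\<Sum>j\<in>N. l u j * - (\<Sum>d<D. m a (Inl j) (Inr d) * x (Inr d)))"
        unfolding h_def sum_distrib_left sum_negf[symmetric]
        by (subst sum.swap) (simp add: mult_ac)
      also have "\<dots> = (\<Sum>j\<in>N. l u j * (\<Sum>w\<in>Z. m a (Inl j) (Inl w) * x (Inl w)))"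
        using main by simp
      also have "\<dots> = (\<Sum>w\<in>Z. (\<Sum>j\<in>N. l u j * m a (Inl j) (Inl w)) * x (Inl w))"
        unfolding sum_distrib_left sum_distrib_right
        by (subst sum.swap) (simp add: mult_ac)
      also have "\<dots> = (\<Sum>w\<in>Z. m a (Inr u) (Inl w) * x (Inl w))"
        using l CZ by (intro sum.cong) auto
      finally show ?thesis .
    qed
    have "(\<Sum>d<D. - x (Inr d) * h v d) = 1"
      unfolding h using row[of "Inr v"] split[of "Inr v"]
      by (simp add: Rows_def m_def K_simps)
    moreover have "(\<Sum>d<D. - x (Inr d) * h u d) = 0" if u: "u \<in> N - C - Z" for u
    proof -
      have "m a (Inr u) (Inl w) = 0" if "w \<in> Z" for w
        using closed[OF cfg that, of u] u by (auto simp: m_def K_simps)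
      then show ?thesis unfolding h by simp
    qed
    ultimately show ?thesis by (intro exI[of _ "\<lambda>d. - x (Inr d)"]) auto
  qed
  then show ?thesis by blast
qed

section \<open>Counting nodes that lie on essential separators\<close>

text \<open>\<open>Y\<close> is one side of the vertex separator \<open>C\<close>. The terminals in \<open>C\<close> count for both sides, so
  \<open>C\<close> separates \<open>Q \<inter> (Y \<union> C)\<close> from \<open>Q - Y\<close>.\<close>

definition separation :: "('n \<Rightarrow> 'n \<Rightarrow> bool) \<Rightarrow> 'n set \<Rightarrow> 'n set \<Rightarrow> 'n set \<Rightarrow> bool" where
  "separation adj N C Y \<longleftrightarrow> C \<subseteq> N \<and> Y \<subseteq> N \<and> C \<inter> Y = {} \<and>
    (\<forall>w\<in>Y. \<forall>u\<in>N. adj u w \<longrightarrow> u \<in> Y \<union> C)"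

definition essential_separator ::
  "('n \<Rightarrow> 'n \<Rightarrow> bool) \<Rightarrow> 'n set \<Rightarrow> 'n set \<Rightarrow> 'n set \<Rightarrow> 'n set \<Rightarrow> 'n \<Rightarrow> bool" where
  "essential_separator adj N Q C Y v \<longleftrightarrow> separation adj N C Y \<and> v \<in> C \<and>
    (\<forall>C' Y'. separation adj N C' Y' \<longrightarrow> Q \<inter> (Y \<union> C) \<subseteq> Y' \<union> C' \<longrightarrow> Q \<inter> Y' \<subseteq> Y \<longrightarrow>
      card C \<le> card C' \<and> (card C' \<le> card C \<longrightarrow> v \<in> C'))"

lemma separation_flip:
  assumes "symp adj" "separation adj N C Y"
  shows "separation adj N C (N - C - Y)"
  using assms unfolding separation_def symp_def by blast

text \<open>Complementing \<open>Y'\<close> to \<open>N - C' - Y'\<close> turns competitors for one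
  side into competitors for the other with the same \<open>C'\<close>. Thus either side of a
  separator may serve as the one with few ports.\<close>

lemma essential_separator_flip:
  assumes "symp adj" "Q \<subseteq> N" and ess: "essential_separator adj N Q C Y v"
  shows "essential_separator adj N Q C (N - C - Y) v"
  unfolding essential_separator_def
proof (intro conjI)
  show "separation adj N C (N - C - Y)" "v \<in> C"
    using separation_flip assms by (auto simp: essential_separator_def)
  have CY: "C \<subseteq> N" "Y \<subseteq> N" "C \<inter> Y = {}"
    using ess by (auto simp: essential_separator_def separation_def)
  show "\<forall>C' Y'. separation adj N C' Y' \<longrightarrow> Q \<inter> (N - C - Y \<union> C) \<subseteq> Y' \<union> C' \<longrightarrow>
      Q \<inter> Y' \<subseteq> N - C - Y \<longrightarrow> card C \<le> card C' \<and> (card C' \<le> card C \<longrightarrow> v \<in> C')"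
  proof (intro allI impI)
    fix C' Y'
    assume sep: "separation adj N C' Y'" and Q1: "Q \<inter> (N - C - Y \<union> C) \<subseteq> Y' \<union> C'"
      and Q2: "Q \<inter> Y' \<subseteq> N - C - Y"
    have "separation adj N C' (N - C' - Y')"
      using separation_flip[OF assms(1) sep] .
    moreover have "Q \<inter> (Y \<union> C) \<subseteq> (N - C' - Y') \<union> C'"
      using Q2 CY by blast
    moreover have "Q \<inter> (N - C' - Y') \<subseteq> Y"
      using Q1 assms(2) by blast
    ultimately show "card C \<le> card C' \<and> (card C' \<le> card C \<longrightarrow> v \<in> C')"
      using ess[unfolded essential_separator_def, THEN conjunct2, THEN conjunct2, rule_format,
          of C' "N - C' - Y'"] by simp
  qed
qed

text \<open>Otherwise, exchanging \<open>R\<close> for its neighbours in \<open>Y\<close> would give a smaller separator, or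
  one that avoids \<open>v\<close>.\<close>

lemma essential_separator_hall:
  assumes finN: "finite N" and refl: "\<And>u. u \<in> N \<Longrightarrow> adj u u"
    and ess: "essential_separator adj N Q C Y v" and v: "v \<notin> Q" and R: "R \<subseteq> C \<union> Y - Q"
  shows "card R \<le> card {z \<in> Y. \<exists>u\<in>R. adj u z}"
    and "card R < card {z \<in> Y. \<exists>u\<in>insert v R. adj u z}"
proof -
  have "separation adj N C Y" and vC: "v \<in> C"
    using ess by (simp_all add: essential_separator_def)
  then have sep: "C \<subseteq> N" "Y \<subseteq> N" "C \<inter> Y = {}" "\<And>w u. w \<in> Y \<Longrightarrow> u \<in> N \<Longrightarrow> adj u w \<Longrightarrow> u \<in> Y \<union> C"
    by (auto simp: separation_def)
  have min: "separation adj N C' Y' \<Longrightarrow> Q \<inter> (Y \<union> C) \<subseteq> Y' \<union> C' \<Longrightarrow> Q \<inter> Y' \<subseteq> Y \<Longrightarrow>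
      card C \<le> card C' \<and> (card C' \<le> card C \<longrightarrow> v \<in> C')" for C' Y'
    using ess by (simp add: essential_separator_def)
  have "R \<subseteq> N" using sep(1,2) R by blast
  then have fin: "finite C" "finite Y" "finite R"
    using sep(1,2) finN by (auto intro: finite_subset[of _ N])
  \<comment> \<open>\<open>U\<close> passes to the far side, and its remaining neighbours in
    \<open>Y\<close> join \<open>C - U\<close> to form \<open>C'\<close>. Taking
    \<open>U = R\<close> yields the first claim. For \<open>U = insert v R\<close> the set
    \<open>C'\<close> misses \<open>v\<close>, so it is strictly larger than \<open>C\<close>, which
    yields the second.\<close>
  have *: "card C \<le> card C' \<and> (card C' \<le> card C \<longrightarrow> v \<in> C') \<and>
      card C' + card R + card ((U - R) \<inter> C) = card {z \<in> Y. \<exists>u\<in>U. adj u z} + card C"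
    if U: "R \<subseteq> U" "U \<subseteq> insert v R" and
      C': "C' = {z \<in> Y - R. \<exists>u\<in>U. adj u z} \<union> (C - U)" for U C'
  proof -
    define M where "M = {z \<in> Y. \<exists>u\<in>U. adj u z}"
    have "separation adj N C' (Y - M)"
      unfolding separation_def
    proof (intro conjI ballI impI)
      show "C' \<subseteq> N" "Y - M \<subseteq> N" "C' \<inter> (Y - M) = {}"
        using sep by (auto simp: C' M_def)
      fix w u assume wu: "w \<in> Y - M" "u \<in> N" "adj u w"
      then have "u \<notin> U" by (auto simp: M_def)
      moreover have "u \<in> Y \<union> C" using wu sep(4) by auto
      ultimately show "u \<in> Y - M \<union> C'" using U by (auto simp: C' M_def)
    qed
    moreover have "Q \<inter> (Y \<union> C) \<subseteq> (Y - M) \<union> C'"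
      using R U v by (auto simp: C' M_def)
    moreover have "Q \<inter> (Y - M) \<subseteq> Y" by auto
    ultimately have "card C \<le> card C' \<and> (card C' \<le> card C \<longrightarrow> v \<in> C')"
      by (rule min)
    moreover have "card C' + card R + card ((U - R) \<inter> C) = card M + card C"
    proof -
      have RM: "R \<inter> Y \<subseteq> M" using refl sep(2) U by (auto simp: M_def)
      have finM: "finite M" using fin by (simp add: M_def)
      have "C' = (M - R) \<union> (C - U)" by (auto simp: C' M_def)
      moreover have "card \<dots> = card (M - R) + card (C - U)"
        by (rule card_Un_disjoint) (use fin finM sep(3) in \<open>auto simp: M_def\<close>)
      ultimately have "card C' = card (M - R) + card (C - U)" by simp
      moreover have "card (M - R) + card (R \<inter> Y) = card M"
      proof -
        have "M \<inter> R = R \<inter> Y" using RM by (auto simp: M_def)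
        then show ?thesis using card_Int_Diff[OF finM, of R] by simp
      qed
      moreover have "card (C \<inter> U) + card (C - U) = card C"
        using card_Int_Diff[OF fin(1), of U] by simp
      moreover have "card (C \<inter> U) = card (R \<inter> C) + card ((U - R) \<inter> C)"
      proof -
        have "C \<inter> U = (R \<inter> C) \<union> ((U - R) \<inter> C)" using U by auto
        moreover have "card \<dots> = card (R \<inter> C) + card ((U - R) \<inter> C)"
          by (rule card_Un_disjoint) (use fin in auto)
        ultimately show ?thesis by simp
      qed
      moreover have "card R = card (R \<inter> Y) + card (R \<inter> C)"
      proof -
        have "R - Y = R \<inter> C" using R sep(3) by auto
        then show ?thesis using card_Int_Diff[OF fin(3), of Y] by simp
      qed
      ultimately show ?thesis by linarith
    qed
    ultimately show ?thesis by (simp add: M_def)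
  qed
  show "card R \<le> card {z \<in> Y. \<exists>u\<in>R. adj u z}"
    using *[OF order_refl subset_insertI HOL.refl] by simp
  show "card R < card {z \<in> Y. \<exists>u\<in>insert v R. adj u z}"
  proof (rule ccontr)
    assume "\<not> ?thesis"
    with *[OF subset_insertI order_refl HOL.refl]
    have "v \<in> {z \<in> Y - R. \<exists>u\<in>insert v R. adj u z} \<union> (C - insert v R)"
      by linarith
    with vC sep(3) show False by auto
  qed
qed

text \<open>The vector of a node \<open>u\<close> is the tensor product of two generic vectors of \<open>u\<close>, one for each
  side, and of a moment vector. The functional of \<open>v\<close>, given by its essential separator \<open>C\<close>, kills
  the nodes on one side of \<open>C\<close> by the first factor, those on the other side by the second one, and
  those in \<open>C - {v}\<close> by the third one.\<close>

lemma card_essential_nodes_le: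
  assumes finN: "finite N" and sym: "symp adj" and refl: "\<And>u. u \<in> N \<Longrightarrow> adj u u"
    and Q: "Q \<subseteq> N" and S: "S \<subseteq> N - Q"
    and ess: "\<And>v. v \<in> S \<Longrightarrow> \<exists>C Y. essential_separator adj N Q C Y v \<and>
      card C < c \<and> card (Q \<inter> Y) + c \<le> D"
  shows "card S \<le> (card Q + c) * D * c"
proof -
  from ess obtain C Y where CY: "\<And>v. v \<in> S \<Longrightarrow> essential_separator adj N Q (C v) (Y v) v"
    "\<And>v. v \<in> S \<Longrightarrow> card (C v) < c" "\<And>v. v \<in> S \<Longrightarrow> card (Q \<inter> Y v) + c \<le> D"
    by metis
  have finS: "finite S" using finN S by (auto intro: finite_subset)
  have finQ: "finite Q" using finN Q by (auto intro: finite_subset)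
  define Z where "Z v = N - C v - Y v" for v
  have essZ: "essential_separator adj N Q (C v) (Z v) v" if "v \<in> S" for v
    unfolding Z_def using essential_separator_flip[OF sym Q] CY that by blast
  have sepY: "C v \<subseteq> N" "Y v \<subseteq> N" "v \<in> C v" "C v \<inter> Y v = {}"
    "\<And>w u. w \<in> Y v \<Longrightarrow> u \<in> N \<Longrightarrow> adj u w \<Longrightarrow> u \<in> Y v \<union> C v" if "v \<in> S" for v
  proof -
    have "separation adj N (C v) (Y v)" "v \<in> C v"
      using CY(1)[OF that] by (simp_all add: essential_separator_def)
    then show "C v \<subseteq> N" "Y v \<subseteq> N" "v \<in> C v" "C v \<inter> Y v = {}"
      "\<And>w u. w \<in> Y v \<Longrightarrow> u \<in> N \<Longrightarrow> adj u w \<Longrightarrow> u \<in> Y v \<union> C v"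
      by (auto simp: separation_def)
  qed
  have sepZ: "\<And>w u. w \<in> Z v \<Longrightarrow> u \<in> N \<Longrightarrow> adj u w \<Longrightarrow> u \<in> Z v \<union> C v" if "v \<in> S" for v
    using essZ[OF that] by (auto simp: essential_separator_def separation_def)
  define D1 where "D1 = card Q + c"
  have "\<exists>h :: _ \<Rightarrow> nat \<Rightarrow> real. \<forall>(v, C, Y)\<in>(\<lambda>v. (v, C v, Y v)) ` S. \<exists>r.
    (\<Sum>d<D1. r d * h v d) \<noteq> 0 \<and> (\<forall>u\<in>N - C - Y. (\<Sum>d<D1. r d * h u d) = 0)"
  proof (rule generic_separating_vectors[OF finN refl Q])
    fix v' C' Y' assume "(v', C', Y') \<in> (\<lambda>v. (v, C v, Y v)) ` S"
    then have v: "v' \<in> S" and eq: "C' = C v'" "Y' = Y v'" by auto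
    show "C' \<subseteq> N \<and> Y' \<subseteq> N \<and> v' \<in> C'" using sepY v eq by auto
    have "card (Q - C' - Y') \<le> card Q" using finQ by (intro card_mono) auto
    then show "card (Q - C' - Y') + card C' < D1" using CY(2)[OF v] eq by (simp add: D1_def)
    show "u \<in> Y' \<union> C'" if "w \<in> Y'" "u \<in> N" "adj u w" for u w
      using sepY(5) v eq that by blast
    have "v' \<notin> Q" using S v by auto
    note essential_separator_hall[OF finN refl CY(1)[OF v] this]
    then show "card R \<le> card {z \<in> Y'. \<exists>u\<in>R. adj u z}"
      "card R < card {z \<in> Y'. \<exists>u\<in>insert v' R. adj u z}" if "R \<subseteq> C' \<union> Y' - Q" for R
      using that eq by auto
  qed (use finS in auto)
  then obtain h1 :: "_ \<Rightarrow> nat \<Rightarrow> real" where "\<forall>v\<in>S. \<exists>r. (\<Sum>d<D1. r d * h1 v d) \<noteq> 0 \<and>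
    (\<forall>u\<in>N - C v - Y v. (\<Sum>d<D1. r d * h1 u d) = 0)" by auto
  then obtain r1 where r1: "\<And>v. v \<in> S \<Longrightarrow> (\<Sum>d<D1. r1 v d * h1 v d) \<noteq> 0"
    "\<And>v u. v \<in> S \<Longrightarrow> u \<in> N - C v - Y v \<Longrightarrow> (\<Sum>d<D1. r1 v d * h1 u d) = 0" by metis
  \<comment> \<open>For the side \<open>Z v\<close> only the ports in \<open>Y v\<close> lie beyond
    the separator. There are at most \<open>D - c\<close> of them, so dimension \<open>D\<close>
    suffices.\<close>
  have "\<exists>h :: _ \<Rightarrow> nat \<Rightarrow> real. \<forall>(v, C, Y)\<in>(\<lambda>v. (v, C v, Z v)) ` S. \<exists>r.
    (\<Sum>d<D. r d * h v d) \<noteq> 0 \<and> (\<forall>u\<in>N - C - Y. (\<Sum>d<D. r d * h u d) = 0)"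
  proof (rule generic_separating_vectors[OF finN refl Q])
    fix v' C' Z' assume "(v', C', Z') \<in> (\<lambda>v. (v, C v, Z v)) ` S"
    then have v: "v' \<in> S" and eq: "C' = C v'" "Z' = Z v'" by auto
    show "C' \<subseteq> N \<and> Z' \<subseteq> N \<and> v' \<in> C'" using sepY v eq by (auto simp: Z_def)
    have "card (Q - C' - Z') \<le> card (Q \<inter> Y v')"
      using finQ Q by (intro card_mono) (auto simp: Z_def eq)
    then show "card (Q - C' - Z') + card C' < D" using CY(2,3)[OF v] eq by simp
    show "u \<in> Z' \<union> C'" if "w \<in> Z'" "u \<in> N" "adj u w" for u w
      using sepZ v eq that by blast
    have "v' \<notin> Q" using S v by auto
    note essential_separator_hall[OF finN refl essZ[OF v] this]
    then show "card R \<le> card {z \<in> Z'. \<exists>u\<in>R. adj u z}"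
      "card R < card {z \<in> Z'. \<exists>u\<in>insert v' R. adj u z}" if "R \<subseteq> C' \<union> Z' - Q" for R
      using that eq by auto
  qed (use finS in auto)
  then obtain h2 :: "_ \<Rightarrow> nat \<Rightarrow> real" where "\<forall>v\<in>S. \<exists>r. (\<Sum>d<D. r d * h2 v d) \<noteq> 0 \<and>
    (\<forall>u\<in>N - C v - Z v. (\<Sum>d<D. r d * h2 u d) = 0)" by auto
  then obtain r2 where r2: "\<And>v. v \<in> S \<Longrightarrow> (\<Sum>d<D. r2 v d * h2 v d) \<noteq> 0"
    "\<And>v u. v \<in> S \<Longrightarrow> u \<in> N - C v - Z v \<Longrightarrow> (\<Sum>d<D. r2 v d * h2 u d) = 0" by metis
  obtain z0 :: "_ \<Rightarrow> nat" where z0: "inj_on z0 N"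
    using finite_imp_inj_to_nat_seg[OF finN] by blast
  define z where "z u = real (z0 u)" for u
  \<comment> \<open>The monic polynomial whose roots are the labels of the other nodes of
    \<open>C v\<close>. Its degree is below \<open>c\<close>, so its value at \<open>z u\<close> is
    a functional of the first \<open>c\<close> powers of \<open>z u\<close>.\<close>
  define p where "p v = (\<Prod>w\<in>C v - {v}. [:- z w, 1:])" for v
  have p: "(\<Sum>i<c. coeff (p v) i * z u ^ i) = (\<Prod>w\<in>C v - {v}. z u - z w)" if v: "v \<in> S" for v u
  proof -
    have "degree (p v) \<le> (\<Sum>w\<in>C v - {v}. degree [:- z w, 1:])"
      unfolding p_def using degree_prod_sum_le[of "C v - {v}" "\<lambda>w. [:- z w, 1:]"]
        finite_subset[OF sepY(1)[OF v] finN] by (simp add: o_def)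
    also have "\<dots> \<le> card (C v)"
      using sepY(1)[OF v] finN by (auto intro!: card_mono intro: finite_subset)
    finally have deg: "degree (p v) < c" using CY(2)[OF v] by simp
    have "(\<Sum>i<c. coeff (p v) i * z u ^ i) = poly (p v) (z u)"
      unfolding poly_altdef
      by (rule sum.mono_neutral_right) (use deg in \<open>auto simp: coeff_eq_0\<close>)
    then show ?thesis by (simp add: p_def poly_prod)
  qed
  define J where "J = {..<D1} \<times> {..<D} \<times> {..<c}"
  define r where "r v = (\<lambda>(d, e, i). r1 v d * (r2 v e * coeff (p v) i))" for v
  define g where "g u = (\<lambda>(d, e, i). h1 u d * (h2 u e * z u ^ i))" for u
  have prod: "(\<Sum>j\<in>J. r v j * g u j) = (\<Sum>d<D1. r1 v d * h1 u d) *
      ((\<Sum>d<D. r2 v d * h2 u d) * (\<Prod>w\<in>C v - {v}. z u - z w))" if v: "v \<in> S" for v u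
  proof -
    have "(\<Sum>j\<in>J. r v j * g u j) = (\<Sum>d<D1. \<Sum>e<D. \<Sum>i<c.
        (r1 v d * h1 u d) * ((r2 v e * h2 u e) * (coeff (p v) i * z u ^ i)))"
      by (simp add: J_def r_def g_def sum.cartesian_product case_prod_unfold mult_ac)
    also have "\<dots> = (\<Sum>d<D1. r1 v d * h1 u d) *
      ((\<Sum>d<D. r2 v d * h2 u d) * (\<Sum>i<c. coeff (p v) i * z u ^ i))"
      unfolding sum_distrib_left[symmetric] sum_distrib_right[symmetric] ..
    finally show ?thesis using p[OF v] by simp
  qed
  have "card S \<le> card J"
  proof (rule card_le_if_diagonal_factorization)
    show "finite J" "finite S" using finS by (auto simp: J_def)
    fix v assume v: "v \<in> S"
    have "finite (C v)" using sepY(1)[OF v] finN by (rule finite_subset)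
    moreover have "z v - z w \<noteq> 0" if "w \<in> C v - {v}" for w
      using z0 that sepY(1,3)[OF v] by (auto simp: z_def inj_on_def)
    ultimately show "(\<Sum>j\<in>J. r v j * g v j) \<noteq> 0"
      using prod[OF v, of v] r1(1)[OF v] r2(1)[OF v] by simp
    fix u assume u: "u \<in> S" "u \<noteq> v"
    then have uN: "u \<in> N" using S by auto
    have "u \<in> C v - {v} \<or> u \<in> N - C v - Y v \<or> u \<in> N - C v - Z v"
      using u uN by (auto simp: Z_def)
    then show "(\<Sum>j\<in>J. r v j * g u j) = 0"
    proof (elim disjE)
      assume "u \<in> C v - {v}"
      then have "(\<Prod>w\<in>C v - {v}. z u - z w) = 0"
        using \<open>finite (C v)\<close> by (intro prod_zero) auto
      then show ?thesis using prod[OF v, of u] by simp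
    qed (use prod[OF v, of u] r1(2)[OF v] r2(2)[OF v] in simp_all)
  qed
  then show ?thesis by (simp add: J_def D1_def mult_ac)
qed

section \<open>Decomposition along small cuts\<close>

text \<open>Hyperedges form an indexed family here, so that parallel copies are told apart and cut
  sizes are cardinalities.\<close>

definition cut_edges :: "'j set \<Rightarrow> ('j \<Rightarrow> 'v set) \<Rightarrow> 'v set \<Rightarrow> 'j set" where
  "cut_edges J E X = {j \<in> J. E j \<inter> X \<noteq> {} \<and> E j - X \<noteq> {}}"

text \<open>\<open>P\<close> holds the pendant hyperedges: so many at each terminal that no
  separator with fewer than \<open>c\<close> nodes contains all of them.\<close>

locale essential_hyperedges =
  fixes V T :: "'v set" and J P :: "'j set" and E :: "'j \<Rightarrow> 'v set" and c :: nat
  assumes finite_V: "finite V" and finite_J: "finite J" and P_subset: "P \<subseteq> J"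
    and E_subset: "\<And>j. j \<in> J \<Longrightarrow> E j \<subseteq> V" and E_nonempty: "\<And>j. j \<in> J \<Longrightarrow> E j \<noteq> {}"
    and pendants: "\<And>t. t \<in> T \<Longrightarrow> c \<le> card {p \<in> P. E p = {t}}"
    and essential: "\<And>j. j \<in> J - P \<Longrightarrow> \<exists>X\<subseteq>V. card (cut_edges J E X) < c \<and>
      (\<forall>X'\<subseteq>V. X' \<inter> T = X \<inter> T \<longrightarrow> card (cut_edges J E X') \<le> card (cut_edges J E X) \<longrightarrow>
        j \<in> cut_edges J E X')"
begin

abbreviation "\<delta> \<equiv> cut_edges J E"

definition nodes :: "'v set \<Rightarrow> 'j set" where
  "nodes U = {j \<in> J. E j \<inter> U \<noteq> {}}"

definition ports :: "'v set \<Rightarrow> 'j set" where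
  "ports U = {j \<in> nodes U. j \<in> P \<or> \<not> E j \<subseteq> U}"

definition adj :: "'v set \<Rightarrow> 'j \<Rightarrow> 'j \<Rightarrow> bool" where
  "adj U i j \<longleftrightarrow> E i \<inter> E j \<inter> U \<noteq> {}"

lemma finite_nodes: "finite (nodes U)"
  using finite_J by (simp add: nodes_def)

lemma finite_ports: "finite (ports U)"
  using finite_nodes by (simp add: ports_def)

lemma finite_cut: "finite (\<delta> X)"
  using finite_J by (simp add: cut_edges_def)

text \<open>The witness given by \<open>essential\<close> need not be a minimum. A minimum one with
  the same trace on \<open>T\<close> is at most as large, so every set that matches it also cuts
  \<open>j\<close>.\<close>

lemma essential_minimum_cut:
  assumes "j \<in> J - P"
  shows "\<exists>X\<subseteq>V. card (\<delta> X) < c \<and> (\<forall>X'\<subseteq>V. X' \<inter> T = X \<inter> T \<longrightarrow>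
    card (\<delta> X) \<le> card (\<delta> X') \<and> (card (\<delta> X') \<le> card (\<delta> X) \<longrightarrow> j \<in> \<delta> X'))"
proof -
  obtain X where X: "X \<subseteq> V" "card (\<delta> X) < c"
    "\<And>X'. X' \<subseteq> V \<Longrightarrow> X' \<inter> T = X \<inter> T \<Longrightarrow> card (\<delta> X') \<le> card (\<delta> X) \<Longrightarrow> j \<in> \<delta> X'"
    using essential[OF assms] by blast
  obtain X0 where X0: "X0 \<subseteq> V \<and> X0 \<inter> T = X \<inter> T"
    "\<And>X'. X' \<subseteq> V \<and> X' \<inter> T = X \<inter> T \<Longrightarrow> card (\<delta> X0) \<le> card (\<delta> X')"
    using ex_has_least_nat[of "\<lambda>X'. X' \<subseteq> V \<and> X' \<inter> T = X \<inter> T" X "\<lambda>X'. card (\<delta> X')"] X(1)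
    by blast
  show ?thesis
  proof (intro exI[of _ X0] conjI allI impI)
    show "X0 \<subseteq> V" "card (\<delta> X0) < c"
      using X0(1) X0(2)[of X] X(1,2) by auto
    fix X' assume X': "X' \<subseteq> V" "X' \<inter> T = X0 \<inter> T"
    show "card (\<delta> X0) \<le> card (\<delta> X')" using X0 X' by auto
    assume "card (\<delta> X') \<le> card (\<delta> X0)"
    then show "j \<in> \<delta> X'"
      using X0(1) X0(2)[of X] X(1) X(3)[of X'] X' by auto
  qed
qed

text \<open>A separator of the part \<open>U\<close> with the same behaviour on the ports can be glued to the global cut
  outside \<open>U\<close>. The pendant hyperedges, being too many to be cut, keep the terminals on their side.\<close>

lemma local_essential_separator:
  assumes X: "X \<subseteq> V" "card (\<delta> X) < c"
    and min: "\<And>X'. X' \<subseteq> V \<Longrightarrow> X' \<inter> T = X \<inter> T \<Longrightarrow>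
      card (\<delta> X) \<le> card (\<delta> X') \<and> (card (\<delta> X') \<le> card (\<delta> X) \<longrightarrow> j \<in> \<delta> X')"
    and U: "U \<subseteq> V" and j: "j \<in> nodes U"
  shows "essential_separator (adj U) (nodes U) (ports U) (\<delta> X \<inter> nodes U) {i \<in> nodes U. E i \<subseteq> X} j"
  unfolding essential_separator_def
proof (intro conjI allI impI)
  let ?C = "\<delta> X \<inter> nodes U" and ?Y = "{i \<in> nodes U. E i \<subseteq> X}"
  show "separation (adj U) (nodes U) ?C ?Y"
    unfolding separation_def
  proof (intro conjI ballI impI)
    fix w u assume "w \<in> ?Y" "u \<in> nodes U" "adj U u w"
    then show "u \<in> ?Y \<union> ?C"
      by (auto simp: adj_def cut_edges_def nodes_def)
  qed (auto simp: cut_edges_def)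
  show "j \<in> ?C" using min[OF X(1)] j by auto
  fix C' Y'
  assume sep: "separation (adj U) (nodes U) C' Y'"
    and A: "ports U \<inter> (?Y \<union> ?C) \<subseteq> Y' \<union> C'" and B: "ports U \<inter> Y' \<subseteq> ?Y"
  have A: "f \<in> Y' \<union> C'" if "f \<in> ports U" "E f \<inter> X \<noteq> {}" for f
    using A that by (auto simp: ports_def cut_edges_def nodes_def)
  have B: "E f \<subseteq> X" if "f \<in> ports U" "f \<in> Y'" for f
    using B that by auto
  have C'Y': "C' \<subseteq> nodes U" "Y' \<subseteq> nodes U" "C' \<inter> Y' = {}"
    using sep by (auto simp: separation_def)
  have closed: "u \<in> Y' \<union> C'" if "w \<in> Y'" "u \<in> nodes U" "E u \<inter> E w \<inter> U \<noteq> {}" for u w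
    using sep that by (auto simp: separation_def adj_def)
  have finC': "finite C'" using C'Y' finite_nodes by (rule_tac finite_subset)
  \<comment> \<open>The glued cut: it agrees with \<open>X\<close> outside \<open>U\<close> and,
    inside \<open>U\<close>, consists of the vertices covered by hyperedges of
    \<open>Y'\<close>.\<close>
  define X' where "X' = (X - U) \<union> {x \<in> U. \<exists>i\<in>Y'. x \<in> E i}"
  have X'V: "X' \<subseteq> V" using X U by (auto simp: X'_def)
  \<comment> \<open>A node outside \<open>C'\<close> has its part in \<open>U\<close> entirely
    inside or entirely outside \<open>X'\<close>. If it leaves \<open>U\<close>, it is a port, and
    \<open>A\<close> and \<open>B\<close> make its part outside \<open>U\<close> agree.\<close>
  have cut_X': "\<delta> X' \<subseteq> (\<delta> X - nodes U) \<union> C'"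
  proof
    fix i assume i: "i \<in> \<delta> X'"
    then have iJ: "i \<in> J" by (simp add: cut_edges_def)
    show "i \<in> (\<delta> X - nodes U) \<union> C'"
    proof (cases "i \<in> nodes U")
      case False
      then have "E i \<inter> U = {}" using iJ by (simp add: nodes_def)
      then have "E i \<inter> X' = E i \<inter> X" "E i - X' = E i - X" by (auto simp: X'_def)
      then show ?thesis using i False by (auto simp: cut_edges_def)
    next
      case node: True
      show ?thesis
      proof (rule ccontr)
        assume "\<not> ?thesis"
        then have iC': "i \<notin> C'" by auto
        show False
        proof (cases "i \<in> Y'")
          case True
          then have "E i \<inter> U \<subseteq> X'" by (auto simp: X'_def)
          with i obtain x where x: "x \<in> E i" "x \<notin> U" "x \<notin> X"
            by (auto simp: cut_edges_def X'_def)
          then have "i \<in> ports U" using node by (auto simp: ports_def)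
          from B[OF this True] x show False by auto
        next
          case False
          then have "E i \<inter> E w \<inter> U = {}" if "w \<in> Y'" for w
            using closed[OF that node] iC' by auto
          with i obtain x where x: "x \<in> E i" "x \<notin> U" "x \<in> X"
            by (auto simp: cut_edges_def X'_def)
          then have "i \<in> ports U" using node by (auto simp: ports_def)
          from A[OF this] x iC' False show False by auto
        qed
      qed
    qed
  qed
  have *: "card ?C \<le> card C' \<and> j \<in> C'" if le: "card C' \<le> card ?C"
  proof -
    have "card ?C \<le> card (\<delta> X)" using finite_cut by (intro card_mono) auto
    then have C'_c: "card C' < c" using le X(2) by simp
    have "t \<in> X' \<longleftrightarrow> t \<in> X" if t: "t \<in> T" for t
    proof (cases "t \<in> U")
      case True
      \<comment> \<open>At least \<open>c\<close> pendant hyperedges at \<open>t\<close> face fewer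
        than \<open>c\<close> elements of \<open>C'\<close>. One that escapes decides the side of
        \<open>t\<close>: it lies in \<open>Y'\<close> exactly if \<open>t \<in> X\<close>.\<close>
      have "\<not> {p \<in> P. E p = {t}} \<subseteq> C'"
        using card_mono[OF finC', of "{p \<in> P. E p = {t}}"] pendants[OF t] C'_c by auto
      then obtain p where p: "p \<in> P" "E p = {t}" "p \<notin> C'" by blast
      then have port: "p \<in> ports U" using True P_subset by (auto simp: ports_def nodes_def)
      then have node: "p \<in> nodes U" by (simp add: ports_def)
      show ?thesis
      proof
        assume "t \<in> X'"
        then obtain w where w: "w \<in> Y'" "t \<in> E w" using True by (auto simp: X'_def)
        then have "p \<in> Y'" using closed[OF w(1) node] p True by auto
        from B[OF port this] p show "t \<in> X" by auto
      next
        assume "t \<in> X"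
        then have "p \<in> Y'" using A[OF port] p by auto
        then show "t \<in> X'" using True p by (auto simp: X'_def)
      qed
    qed (auto simp: X'_def)
    then have "X' \<inter> T = X \<inter> T" by auto
    note min' = min[OF X'V this]
    have "card (\<delta> X') \<le> card ((\<delta> X - nodes U) \<union> C')"
      using cut_X' finite_cut finC' by (intro card_mono) auto
    also have "\<dots> \<le> card (\<delta> X - nodes U) + card C'"
      by (rule card_Un_le)
    finally have "card (\<delta> X') + card ?C \<le> card (\<delta> X) + card C'"
      using card_Int_Diff[OF finite_cut, of X "nodes U"] by simp
    with min' le have "card ?C \<le> card C'" "j \<in> \<delta> X'" by auto
    with cut_X' j show ?thesis by auto
  qed
  show "card ?C \<le> card C'" using * by (meson nle_le)
  show "j \<in> C'" if "card C' \<le> card ?C" using * that by blast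
qed

text \<open>A minimum cut for which a nonport is essential crosses \<open>U\<close> in fewer than
  \<open>c\<close> hyperedges, so unsplittability leaves fewer than \<open>4 * c\<close> ports on
  one side. After a possible flip this side is \<open>Y\<close>, and \<open>5 * c\<close> accounts
  for these ports and the extra \<open>c\<close> in the bound for essential nodes.\<close>

lemma card_nonports_le:
  assumes U: "U \<subseteq> V"
    and unsplittable: "\<And>X. X \<subseteq> V \<Longrightarrow> card {j \<in> J. E j \<inter> (U \<inter> X) \<noteq> {} \<and> E j \<inter> (U - X) \<noteq> {}} < c \<Longrightarrow>
      card (ports (U \<inter> X)) < 4 * c \<or> card (ports (U - X)) < 4 * c"
  shows "card (nodes U - ports U) \<le> (card (ports U) + c) * (5 * c) * c"
proof (rule card_essential_nodes_le)
  show "finite (nodes U)" by (rule finite_nodes)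
  show symp: "symp (adj U)" by (auto simp: symp_def adj_def)
  show "adj U u u" if "u \<in> nodes U" for u
    using that by (simp add: adj_def nodes_def)
  show ports: "ports U \<subseteq> nodes U" by (auto simp: ports_def)
  show "nodes U - ports U \<subseteq> nodes U - ports U" ..
  fix j assume j: "j \<in> nodes U - ports U"
  then have "j \<in> J - P" by (auto simp: ports_def nodes_def)
  from essential_minimum_cut[OF this] obtain X where X: "X \<subseteq> V" "card (\<delta> X) < c"
    and min: "\<And>X'. X' \<subseteq> V \<Longrightarrow> X' \<inter> T = X \<inter> T \<Longrightarrow>
      card (\<delta> X) \<le> card (\<delta> X') \<and> (card (\<delta> X') \<le> card (\<delta> X) \<longrightarrow> j \<in> \<delta> X')"
    by blast
  let ?C = "\<delta> X \<inter> nodes U" and ?Y = "{i \<in> nodes U. E i \<subseteq> X}"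
  have ess: "essential_separator (adj U) (nodes U) (ports U) ?C ?Y j"
    using local_essential_separator[OF X min U] j by blast
  have "card ?C \<le> card (\<delta> X)" using finite_cut by (intro card_mono) auto
  then have C: "card ?C < c" using X(2) by simp
  have "card {j \<in> J. E j \<inter> (U \<inter> X) \<noteq> {} \<and> E j \<inter> (U - X) \<noteq> {}} \<le> card (\<delta> X)"
    using finite_cut by (intro card_mono) (auto simp: cut_edges_def)
  then have "card (ports (U \<inter> X)) < 4 * c \<or> card (ports (U - X)) < 4 * c"
    using X by (intro unsplittable) auto
  then show "\<exists>C Y. essential_separator (adj U) (nodes U) (ports U) C Y j \<and>
      card C < c \<and> card (ports U \<inter> Y) + c \<le> 5 * c"
  proof
    assume small: "card (ports (U \<inter> X)) < 4 * c"
    have "ports U \<inter> ?Y \<subseteq> ports (U \<inter> X)"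
      by (auto simp: ports_def nodes_def)
    then have "card (ports U \<inter> ?Y) \<le> card (ports (U \<inter> X))"
      using finite_ports by (intro card_mono) auto
    with ess C small show ?thesis by (intro exI[of _ ?C] exI[of _ ?Y]) auto
  next
    assume small: "card (ports (U - X)) < 4 * c"
    have "ports U \<inter> (nodes U - ?C - ?Y) \<subseteq> ports (U - X)"
      by (auto simp: ports_def nodes_def cut_edges_def)
    then have "card (ports U \<inter> (nodes U - ?C - ?Y)) \<le> card (ports (U - X))"
      using finite_ports by (intro card_mono) auto
    with essential_separator_flip[OF symp ports ess] C small show ?thesis
      by (intro exI[of _ ?C] exI[of _ "nodes U - ?C - ?Y"]) auto
  qed
qed

text \<open>Induction over the splits of \<open>U\<close>: the summand \<open>30 * c ^ 3\<close> pays for the fewer than \<open>2 * c\<close> ports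
  that a split creates.\<close>

lemma card_nodes_le:
  assumes "U \<subseteq> V" "4 * c \<le> card (ports U)" "0 < c"
  shows "card (nodes U - P) + 30 * c ^ 3 \<le> 15 * c\<^sup>2 * card (ports U)"
  using assms
proof (induction "card U" arbitrary: U rule: less_induct)
  case less
  have finU: "finite U" using less.prems(1) finite_V by (rule finite_subset)
  show ?case
  proof (cases "\<exists>X\<subseteq>V. card {j \<in> J. E j \<inter> (U \<inter> X) \<noteq> {} \<and> E j \<inter> (U - X) \<noteq> {}} < c \<and>
      4 * c \<le> card (ports (U \<inter> X)) \<and> 4 * c \<le> card (ports (U - X))")
    case False
    then have "card (nodes U - ports U) \<le> (card (ports U) + c) * (5 * c) * c"
      using card_nonports_le[OF less.prems(1)] by (meson not_le)
    \<comment> \<open>With \<open>p = card (ports U) \<ge> 4 * c\<close>, the contributions are at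
      most 5, 1 and 35/4 times \<open>c\<^sup>2 * p\<close>, the last one from
      \<open>5 * c ^ 3 + 30 * c ^ 3\<close>. The sum of the factors is below 15.\<close>
    then have "card (nodes U - ports U) \<le> 5 * (c\<^sup>2 * card (ports U)) + 5 * c ^ 3"
      by (simp add: algebra_simps power2_eq_square power3_eq_cube)
    moreover have "card (nodes U - P) \<le> card ((nodes U - ports U) \<union> ports U)"
      using finite_nodes finite_ports by (intro card_mono) auto
    moreover have "\<dots> \<le> card (nodes U - ports U) + card (ports U)"
      by (rule card_Un_le)
    moreover have "1 * card (ports U) \<le> c\<^sup>2 * card (ports U)"
      using less.prems(3) by (intro mult_right_mono) (auto simp: Suc_le_eq)
    moreover have "c\<^sup>2 * (4 * c) \<le> c\<^sup>2 * card (ports U)"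
      using less.prems(2) by (intro mult_left_mono) auto
    then have "4 * c ^ 3 \<le> c\<^sup>2 * card (ports U)"
      by (simp add: power2_eq_square power3_eq_cube mult_ac)
    ultimately have "card (nodes U - P) + 30 * c ^ 3 \<le> 15 * (c\<^sup>2 * card (ports U))"
      by linarith
    then show ?thesis by (simp add: mult.assoc)
  next
    case True
    then obtain X where X: "X \<subseteq> V"
      and cross: "card {j \<in> J. E j \<inter> (U \<inter> X) \<noteq> {} \<and> E j \<inter> (U - X) \<noteq> {}} < c"
      and big: "4 * c \<le> card (ports (U \<inter> X))" "4 * c \<le> card (ports (U - X))" by blast
    define R where "R = {j \<in> J. E j \<inter> (U \<inter> X) \<noteq> {} \<and> E j \<inter> (U - X) \<noteq> {}}"
    have finR: "finite R" using finite_J by (simp add: R_def)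
    have "W \<noteq> {}" if "4 * c \<le> card (ports W)" for W
      using that less.prems(3) by (auto simp: ports_def nodes_def)
    then have "U \<inter> X \<noteq> {}" "U - X \<noteq> {}" using big by blast+
    then have smaller: "card (U \<inter> X) < card U" "card (U - X) < card U"
      using finU by (auto intro!: psubset_card_mono)
    have IH: "card (nodes (U \<inter> X) - P) + 30 * c ^ 3 \<le> 15 * c\<^sup>2 * card (ports (U \<inter> X))"
      "card (nodes (U - X) - P) + 30 * c ^ 3 \<le> 15 * c\<^sup>2 * card (ports (U - X))"
      using less.hyps[OF smaller(1)] less.hyps[OF smaller(2)] less.prems big by auto
    have "card (nodes U - P) \<le> card ((nodes (U \<inter> X) - P) \<union> (nodes (U - X) - P))"
      using finite_nodes by (intro card_mono) (auto simp: nodes_def)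
    also have "\<dots> \<le> card (nodes (U \<inter> X) - P) + card (nodes (U - X) - P)"
      by (rule card_Un_le)
    finally have nodes: "card (nodes U - P) \<le> \<dots>" .
    \<comment> \<open>A port of a part that does not cross the split is already a port of
      \<open>U\<close>, and belongs to one part only. So only the fewer than \<open>c\<close>
      hyperedges of \<open>R\<close> can be counted in excess, at most once in each part.\<close>
    define A where "A = ports (U \<inter> X) - R"
    define B where "B = ports (U - X) - R"
    have "A \<inter> B = {}" "A \<union> B \<subseteq> ports U"
      by (auto simp: A_def B_def ports_def nodes_def R_def)
    then have "card A + card B \<le> card (ports U)"
      using finite_ports by (metis A_def B_def card_Un_disjoint card_mono finite_Diff)
    moreover have "card (ports (U \<inter> X)) \<le> card (A \<union> R)" "card (ports (U - X)) \<le> card (B \<union> R)"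
      using finite_ports finR by (auto simp: A_def B_def intro!: card_mono)
    moreover have "card (A \<union> R) \<le> card A + card R" "card (B \<union> R) \<le> card B + card R"
      by (rule card_Un_le)+
    ultimately have "card (ports (U \<inter> X)) + card (ports (U - X)) \<le> card (ports U) + 2 * c"
      using cross by (simp add: R_def)
    then have "15 * c\<^sup>2 * (card (ports (U \<inter> X)) + card (ports (U - X))) \<le> 15 * c\<^sup>2 * (card (ports U) + 2 * c)"
      by (rule mult_left_mono) simp
    moreover have "15 * c\<^sup>2 * (card (ports U) + 2 * c) = 15 * c\<^sup>2 * card (ports U) + 30 * c ^ 3"
      by (simp add: algebra_simps power2_eq_square power3_eq_cube)
    ultimately show ?thesis
      using IH nodes by (simp only: distrib_left)
  qed
qed

lemma card_nonpendants_le: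
  assumes "4 * c \<le> card P" "0 < c"
  shows "card (J - P) \<le> 15 * c\<^sup>2 * card P"
proof -
  have "nodes V = J" using E_subset E_nonempty by (fastforce simp: nodes_def)
  moreover have "ports V = P" using calculation P_subset E_subset by (auto simp: ports_def)
  ultimately show ?thesis using card_nodes_le[of V] assms by simp
qed

end

text \<open>The added pendant hyperedges are singletons, which no set cuts, so essentiality is
  unaffected. With \<open>4 * c\<close> of them per terminal the constant is
  \<open>60 = 15 * 4\<close>.\<close>

lemma card_essential_hyperedges_le:
  fixes E :: "'i \<Rightarrow> 'v set"
  assumes "finite V" "finite I" "T \<subseteq> V" "0 < c"
    and E: "\<And>i. i \<in> I \<Longrightarrow> E i \<subseteq> V \<and> E i \<noteq> {}"
    and essential: "\<And>i. i \<in> I \<Longrightarrow> \<exists>X\<subseteq>V. card (cut_edges I E X) < c \<and>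
      (\<forall>X'\<subseteq>V. X' \<inter> T = X \<inter> T \<longrightarrow> card (cut_edges I E X') \<le> card (cut_edges I E X) \<longrightarrow>
        i \<in> cut_edges I E X')"
  shows "card I \<le> 60 * card T * c ^ 3"
proof (cases "T = {}")
  case True
  have "I = {}"
  proof (rule ccontr)
    assume "I \<noteq> {}"
    then obtain i where "i \<in> I" by blast
    from essential[OF this] obtain X where
      "\<forall>X'\<subseteq>V. X' \<inter> T = X \<inter> T \<longrightarrow> card (cut_edges I E X') \<le> card (cut_edges I E X) \<longrightarrow> i \<in> cut_edges I E X'"
      by blast
    from this[rule_format, of "{}"] True show False by (simp add: cut_edges_def)
  qed
  then show ?thesis by simp
next
  case False
  have finT: "finite T" using assms by (auto intro: finite_subset)
  \<comment> \<open>Each terminal gets \<open>4 * c\<close> pendant hyperedges, so that even a single terminal provides the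
    number of ports required by \<open>card_nodes_le\<close>.\<close>
  define P :: "('i + 'v \<times> nat) set" where "P = Inr ` (T \<times> {..<4 * c})"
  define E' :: "'i + 'v \<times> nat \<Rightarrow> 'v set" where "E' = case_sum E (\<lambda>(t, n). {t})"
  define J :: "('i + 'v \<times> nat) set" where "J = Inl ` I \<union> P"
  have cut': "cut_edges J E' X = Inl ` cut_edges I E X" for X
    unfolding J_def P_def E'_def cut_edges_def by (auto simp: image_iff)
  have card_cut': "card (Inl ` cut_edges I E X :: ('i + 'v \<times> nat) set) = card (cut_edges I E X)" for X
    by (simp add: card_image)
  have J_P: "J - P = Inl ` I" by (auto simp: J_def P_def)
  interpret essential_hyperedges V T J P E' c
  proof
    show "finite V" by fact
    show "finite J" using assms finT by (simp add: J_def P_def)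
    show "P \<subseteq> J" by (simp add: J_def)
    show "E' j \<subseteq> V" "E' j \<noteq> {}" if "j \<in> J" for j
      using that E \<open>T \<subseteq> V\<close> by (fastforce simp: J_def P_def E'_def)+
    show "c \<le> card {p \<in> P. E' p = {t}}" if t: "t \<in> T" for t
    proof -
      have "{p \<in> P. E' p = {t}} = (\<lambda>n. Inr (t, n)) ` {..<4 * c}"
        using t by (auto simp: P_def E'_def)
      then show ?thesis by (simp add: card_image inj_on_def)
    qed
    fix j assume "j \<in> J - P"
    then obtain i where i: "i \<in> I" "j = Inl i" using J_P by auto
    show "\<exists>X\<subseteq>V. card (cut_edges J E' X) < c \<and>
        (\<forall>X'\<subseteq>V. X' \<inter> T = X \<inter> T \<longrightarrow> card (cut_edges J E' X') \<le> card (cut_edges J E' X) \<longrightarrow>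
          j \<in> cut_edges J E' X')"
      unfolding cut' card_cut' i(2) inj_image_mem_iff[OF inj_Inl] using essential[OF i(1)] .
  qed
  have cardP: "card P = card T * (4 * c)"
    by (simp add: P_def card_image card_cartesian_product)
  have "1 \<le> card T" using False finT by (simp add: Suc_le_eq card_gt_0_iff)
  then have "4 * c \<le> card P" unfolding cardP using mult_le_mono1 by fastforce
  from card_nonpendants_le[OF this \<open>0 < c\<close>]
  have "card I \<le> 15 * c\<^sup>2 * (card T * (4 * c))"
    unfolding J_P cardP by (simp add: card_image)
  also have "\<dots> = 60 * card T * c ^ 3"
    by (simp add: power2_eq_square power3_eq_cube)
  finally show ?thesis .
qed

section \<open>Cuts of a contraction\<close>

lemma contraction_map_eq_iff:
  "contraction_map F u = contraction_map F v \<longleftrightarrow> (u, v) \<in> {(u, w). \<exists>f\<in>#F. u \<in> f \<and> w \<in> f}\<^sup>*"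
    (is "_ \<longleftrightarrow> _ \<in> ?R\<^sup>*")
proof
  assume "contraction_map F u = contraction_map F v"
  moreover have "v \<in> contraction_map F v" by (simp add: contraction_map_def)
  ultimately have "v \<in> contraction_map F u" by simp
  then show "(u, v) \<in> ?R\<^sup>*" by (simp add: contraction_map_def)
next
  assume uv: "(u, v) \<in> ?R\<^sup>*"
  have "sym ?R" by (auto simp: sym_def)
  then have "(v, u) \<in> ?R\<^sup>*" using uv by (meson sym_rtrancl symD)
  with uv show "contraction_map F u = contraction_map F v"
    unfolding contraction_map_def by (auto intro: rtrancl_trans)
qed

lemma contraction_map_eq_mono:
  assumes "F \<subseteq># F'" "contraction_map F u = contraction_map F v"
  shows "contraction_map F' u = contraction_map F' v"
proof -
  have "{(u, w). \<exists>f\<in>#F. u \<in> f \<and> w \<in> f} \<subseteq> {(u, w). \<exists>f\<in>#F'. u \<in> f \<and> w \<in> f}"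
    using mset_subset_eqD[OF assms(1)] by blast
  from rtrancl_mono[OF this] show ?thesis
    using assms(2) unfolding contraction_map_eq_iff by blast
qed

text \<open>For \<open>X \<subseteq> verts G\<close> and \<open>F \<subseteq># hedges G\<close> in a
  well-formed \<open>G\<close>, these are the unions of blocks, that is, the preimages of vertex
  sets of the contraction.\<close>

definition uncut :: "'a set multiset \<Rightarrow> 'a set \<Rightarrow> bool" where
  "uncut F X \<longleftrightarrow> (\<forall>f\<in>#F. f \<inter> X = {} \<or> f \<subseteq> X)"

lemma uncut_mono: "F \<subseteq># F' \<Longrightarrow> uncut F' X \<Longrightarrow> uncut F X"
  unfolding uncut_def by (auto dest: mset_subset_eqD)

lemma uncut_contraction_map:
  assumes "uncut F X" "contraction_map F u = contraction_map F v" "u \<in> X"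
  shows "v \<in> X"
  using assms(2,3) unfolding contraction_map_eq_iff
proof (induction rule: rtrancl_induct)
  case (step y z)
  then show ?case using assms(1) by (auto simp: uncut_def)
qed

lemma uncut_vimage:
  assumes "wf_hypergraph G" "F \<subseteq># hedges G"
  shows "uncut F {v \<in> verts G. contraction_map F v \<in> Y}"
proof -
  have "contraction_map F u = contraction_map F v" if "f \<in># F" "u \<in> f" "v \<in> f" for f u v
    unfolding contraction_map_eq_iff using that by blast
  moreover have "f \<subseteq> verts G" if "f \<in># F" for f
    using assms that by (auto simp: wf_hypergraph_def dest: mset_subset_eqD)
  ultimately show ?thesis unfolding uncut_def by (smt (verit) disjoint_iff mem_Collect_eq subset_iff)
qed

lemma uncut_eq_vimage:
  assumes "uncut F X" "X \<subseteq> verts G"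
  shows "{v \<in> verts G. contraction_map F v \<in> contraction_map F ` X} = X"
proof (intro equalityI subsetI)
  fix v assume "v \<in> {v \<in> verts G. contraction_map F v \<in> contraction_map F ` X}"
  then obtain u where "contraction_map F u = contraction_map F v" "u \<in> X" by auto
  then show "v \<in> X" by (rule uncut_contraction_map[OF assms(1)])
qed (use assms(2) in auto)

lemma size_boundary_kept:
  assumes "F \<subseteq># hedges G" "uncut F X"
  shows "size (boundary G X) = size {#e \<in># hedges G - F. e \<inter> X \<noteq> {} \<and> e \<inter> (verts G - X) \<noteq> {}#}"
proof -
  let ?P = "\<lambda>e. e \<inter> X \<noteq> {} \<and> e \<inter> (verts G - X) \<noteq> {}"
  have "boundary G X = filter_mset ?P ((hedges G - F) + F)"
    using assms(1) by (simp add: boundary_def)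
  also have "\<dots> = filter_mset ?P (hedges G - F) + filter_mset ?P F"
    by (rule filter_union_mset)
  also have "filter_mset ?P F = {#}"
    using assms(2) by (auto simp: uncut_def)
  finally show ?thesis by simp
qed

lemma size_boundary_contract:
  assumes wf: "wf_hypergraph G" and F: "F \<subseteq># hedges G" and Y: "Y \<subseteq> contraction_map F ` verts G"
  shows "size (boundary (contract G F) Y) = size (boundary G {v \<in> verts G. contraction_map F v \<in> Y})"
    (is "_ = size (boundary G ?X)")
proof -
  let ?\<pi> = "contraction_map F"
  have "size (boundary (contract G F) Y)
    = size {#e \<in># hedges G - F. ?\<pi> ` e \<inter> Y \<noteq> {} \<and> ?\<pi> ` e \<inter> (?\<pi> ` verts G - Y) \<noteq> {}#}"
    by (simp add: boundary_def contract_def filter_mset_image_mset)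
  also have "{#e \<in># hedges G - F. ?\<pi> ` e \<inter> Y \<noteq> {} \<and> ?\<pi> ` e \<inter> (?\<pi> ` verts G - Y) \<noteq> {}#}
    = {#e \<in># hedges G - F. e \<inter> ?X \<noteq> {} \<and> e \<inter> (verts G - ?X) \<noteq> {}#}"
  proof (rule filter_mset_cong[OF HOL.refl])
    fix e assume "e \<in># hedges G - F"
    then have "e \<subseteq> verts G" using wf by (auto simp: wf_hypergraph_def dest: in_diffD)
    then show "(?\<pi> ` e \<inter> Y \<noteq> {} \<and> ?\<pi> ` e \<inter> (?\<pi> ` verts G - Y) \<noteq> {}) =
        (e \<inter> ?X \<noteq> {} \<and> e \<inter> (verts G - ?X) \<noteq> {})"
      by blast
  qed
  finally show ?thesis
    using size_boundary_kept[OF F uncut_vimage[OF wf F]] by simp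
qed

text \<open>Taking preimages maps the cuts of the contraction onto the cuts of \<open>G\<close> that
  respect the blocks, and keeps their values. If a block meets both \<open>A\<close> and
  \<open>B\<close>, both infima range over the empty set.\<close>

lemma mincut_contract:
  assumes wf: "wf_hypergraph G" and F: "F \<subseteq># hedges G"
    and A: "A \<subseteq> verts G" and B: "B \<subseteq> verts G"
  shows "mincut (contract G F) (contraction_map F ` A) (contraction_map F ` B)
    = (INF X \<in> {X \<in> cuts G A B. uncut F X}. enat (size (boundary G X)))"
proof -
  let ?\<pi> = "contraction_map F"
  let ?vimage = "\<lambda>Y. {v \<in> verts G. ?\<pi> v \<in> Y}"
  let ?cuts = "cuts (contract G F) (?\<pi> ` A) (?\<pi> ` B)"
  have verts: "verts (contract G F) = ?\<pi> ` verts G" by (simp add: contract_def)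
  have im: "?vimage ` ?cuts = {X \<in> cuts G A B. uncut F X}"
  proof (intro equalityI subsetI)
    fix X assume "X \<in> ?vimage ` ?cuts"
    then obtain Y where Y: "Y \<in> ?cuts" "X = ?vimage Y" by blast
    then have "X \<in> cuts G A B" using A B by (auto simp: cuts_def)
    with Y uncut_vimage[OF wf F, of Y] show "X \<in> {X \<in> cuts G A B. uncut F X}" by simp
  next
    fix X assume "X \<in> {X \<in> cuts G A B. uncut F X}"
    then have X: "X \<subseteq> verts G" "A \<subseteq> X" "B \<subseteq> verts G - X" "uncut F X" by (auto simp: cuts_def)
    have eq: "X = ?vimage (?\<pi> ` X)" using uncut_eq_vimage[OF X(4,1)] by simp
    have "?\<pi> ` X \<in> ?cuts"
      unfolding cuts_def verts
    proof (intro CollectI conjI)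
      have "?\<pi> v \<notin> ?\<pi> ` X" if "v \<in> B" for v
      proof
        assume "?\<pi> v \<in> ?\<pi> ` X"
        then obtain u where "?\<pi> u = ?\<pi> v" "u \<in> X" by auto
        then have "v \<in> X" by (rule uncut_contraction_map[OF X(4)])
        then show False using X(3) that by auto
      qed
      then show "?\<pi> ` B \<subseteq> ?\<pi> ` verts G - ?\<pi> ` X"
        using X(3) by auto
    qed (use X in auto)
    with eq show "X \<in> ?vimage ` ?cuts" by blast
  qed
  have "(INF Y \<in> ?cuts. enat (size (boundary (contract G F) Y)))
    = (INF Y \<in> ?cuts. enat (size (boundary G (?vimage Y))))"
  proof (intro INF_cong HOL.refl)
    fix Y assume "Y \<in> ?cuts"
    then have "Y \<subseteq> ?\<pi> ` verts G" by (simp add: cuts_def verts)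
    then show "enat (size (boundary (contract G F) Y)) = enat (size (boundary G (?vimage Y)))"
      using size_boundary_contract[OF wf F] by simp
  qed
  also have "\<dots> = (INF X \<in> ?vimage ` ?cuts. enat (size (boundary G X)))"
    unfolding image_image ..
  finally show ?thesis
    unfolding mincut_def im .
qed

text \<open>Only values below \<open>c\<close> survive the truncation, and an infimum below
  \<open>c\<close> is attained. \<open>A\<close> will be the set of all cuts and \<open>B\<close>
  the set of those that survive a contraction.\<close>

lemma min_INF_subset_eq_iff:
  fixes b :: "'x \<Rightarrow> nat"
  assumes "B \<subseteq> A"
  shows "min (INF x\<in>A. enat (b x)) (enat c) = min (INF x\<in>B. enat (b x)) (enat c) \<longleftrightarrow>
    (\<forall>x\<in>A. b x < c \<longrightarrow> (\<exists>y\<in>B. b y \<le> b x))"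
    (is "min ?a _ = min ?b _ \<longleftrightarrow> _")
proof (intro iffI ballI impI)
  fix x assume eq: "min ?a (enat c) = min ?b (enat c)" and x: "x \<in> A" "b x < c"
  have "?a \<le> enat (b x)" using x by (intro INF_lower)
  then have "min ?b (enat c) \<le> enat (b x)" unfolding eq[symmetric] by (simp add: min.coboundedI1)
  then have "?b < enat (Suc (b x))"
    using x(2) by (auto simp: min_le_iff_disj intro: le_less_trans)
  then show "\<exists>y\<in>B. b y \<le> b x"
    unfolding INF_less_iff by (auto simp: less_Suc_eq_le)
next
  assume *: "\<forall>x\<in>A. b x < c \<longrightarrow> (\<exists>y\<in>B. b y \<le> b x)"
  show "min ?a (enat c) = min ?b (enat c)"
  proof (rule antisym)
    show "min ?a (enat c) \<le> min ?b (enat c)"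
      using INF_superset_mono[OF assms, of "\<lambda>x. enat (b x)" "\<lambda>x. enat (b x)"]
      by (intro min.mono) auto
    show "min ?b (enat c) \<le> min ?a (enat c)"
    proof (cases "?a < enat c")
      case True
      then obtain x0 where x0: "x0 \<in> A" "b x0 < c" by (auto simp: INF_less_iff)
      have "?b \<le> enat (b x)" if x: "x \<in> A" for x
      proof -
        obtain x' where x': "x' \<in> A" "b x' < c" "b x' \<le> b x"
          using x x0 by (cases "b x < c") auto
        then obtain y where "y \<in> B" "b y \<le> b x'" using * by blast
        then show ?thesis using x'(3) by (intro INF_lower2[of y]) auto
      qed
      then have "?b \<le> ?a" by (intro INF_greatest)
      then show ?thesis by (simp add: min.coboundedI1)
    qed (simp add: min.coboundedI2)
  qed
qed

text \<open>The sparsifier condition for the contraction of \<open>F\<close>, expressed inside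
  \<open>G\<close>. It passes to smaller \<open>F\<close>, so keeping further hyperedges never
  spoils it.\<close>

definition preserves_cuts :: "'a hypergraph \<Rightarrow> 'a set \<Rightarrow> nat \<Rightarrow> 'a set multiset \<Rightarrow> bool" where
  "preserves_cuts G T c F \<longleftrightarrow> (\<forall>T1 T2. T1 \<subseteq> T \<longrightarrow> T2 \<subseteq> T \<longrightarrow> T1 \<inter> T2 = {} \<longrightarrow>
    (\<forall>X\<in>cuts G T1 T2. size (boundary G X) < c \<longrightarrow>
      (\<exists>X'\<in>cuts G T1 T2. uncut F X' \<and> size (boundary G X') \<le> size (boundary G X))))"

lemma preserves_cuts_mono:
  "F \<subseteq># F' \<Longrightarrow> preserves_cuts G T c F' \<Longrightarrow> preserves_cuts G T c F"
  unfolding preserves_cuts_def by (meson uncut_mono)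

lemma contraction_sparsifier_iff_preserves_cuts:
  assumes wf: "wf_hypergraph G" and T: "T \<subseteq> verts G" and F: "F \<subseteq># hedges G"
  shows "contraction_sparsifier (contraction_map F) T c G (contract G F) \<longleftrightarrow> preserves_cuts G T c F"
proof -
  have "wf_hypergraph (contract G F)"
    using wf by (auto simp: wf_hypergraph_def contract_def dest!: in_diffD)
  moreover have "contraction_map F ` verts G = verts (contract G F)"
    by (simp add: contract_def)
  moreover have "\<forall>h\<in>#hedges (contract G F). \<exists>f\<in>#hedges G. h = contraction_map F ` f"
    by (auto simp: contract_def dest: in_diffD)
  moreover have "mincut_upto c G T1 T2
      = mincut_upto c (contract G F) (contraction_map F ` T1) (contraction_map F ` T2) \<longleftrightarrow>
    (\<forall>X\<in>cuts G T1 T2. size (boundary G X) < c \<longrightarrow>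
      (\<exists>X'\<in>cuts G T1 T2. uncut F X' \<and> size (boundary G X') \<le> size (boundary G X)))"
    if "T1 \<subseteq> T" "T2 \<subseteq> T" for T1 T2
  proof -
    have "T1 \<subseteq> verts G" "T2 \<subseteq> verts G" using that T by auto
    note eq = mincut_contract[OF wf F this]
    show ?thesis
      unfolding mincut_upto_def eq unfolding mincut_def
      by (subst min_INF_subset_eq_iff) auto
  qed
  then have "(\<forall>T1 T2. T1 \<subseteq> T \<longrightarrow> T2 \<subseteq> T \<longrightarrow> T1 \<inter> T2 = {} \<longrightarrow> mincut_upto c G T1 T2
      = mincut_upto c (contract G F) (contraction_map F ` T1) (contraction_map F ` T2)) \<longleftrightarrow>
    preserves_cuts G T c F"
    unfolding preserves_cuts_def by (intro all_cong1 imp_cong HOL.refl) simp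
  ultimately show ?thesis
    unfolding contraction_sparsifier_def by argo
qed

section \<open>The sparsifier\<close>

lemma card_nth_eq_size_filter_mset:
  "card {i \<in> {..<length xs}. P (xs ! i)} = size (filter_mset P (mset xs))"
proof -
  have "{i \<in> {..<length xs}. P (xs ! i)} = {i. i < length xs \<and> P (xs ! i)}" by auto
  then show ?thesis
    by (simp add: length_filter_conv_card[symmetric] flip: mset_filter)
qed

text \<open>By minimality, contracting one more kept hyperedge destroys some cut of value below
  \<open>c\<close>. Hence every kept hyperedge is essential in the contraction, with the images of
  the terminals as terminals, and the bound on essential hyperedges applies there.\<close>

lemma small_minimal_kept_edges:
  assumes wf: "wf_hypergraph G" and T: "T \<subseteq> verts G" and c: "0 < c"
    and E': "E' \<subseteq># hedges G" and pres: "preserves_cuts G T c (hedges G - E')"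
    and minimal: "\<And>E''. E'' \<subseteq># hedges G \<Longrightarrow> size E'' < size E' \<Longrightarrow>
      \<not> preserves_cuts G T c (hedges G - E'')"
  shows "size E' \<le> 60 * card T * c ^ 3"
proof -
  obtain xs where xs: "mset xs = E'" using ex_mset by blast
  define F where "F = hedges G - E'"
  define \<pi> where "\<pi> = contraction_map F"
  define I where "I = {..<length xs}"
  define E where "E i = \<pi> ` (xs ! i)" for i
  define X_of where "X_of Y = {v \<in> verts G. \<pi> v \<in> Y}" for Y
  have F: "F \<subseteq># hedges G" by (simp add: F_def)
  have kept: "hedges G - F = E'" using E' by (simp add: F_def subset_mset.diff_diff_right)
  have finV: "finite (verts G)" using wf by (simp add: wf_hypergraph_def)
  have xsE': "xs ! i \<in># E'" if "i \<in> I" for i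
    using that xs by (auto simp: I_def)
  have edge: "xs ! i \<subseteq> verts G \<and> xs ! i \<noteq> {}" if "i \<in> I" for i
    using xsE'[OF that] wf mset_subset_eqD[OF E'] by (auto simp: wf_hypergraph_def)
  have card_cut: "card (cut_edges I E Y) = size (boundary G (X_of Y))"
    if Y: "Y \<subseteq> \<pi> ` verts G" for Y
  proof -
    have "cut_edges I E Y = {i \<in> I. xs ! i \<inter> X_of Y \<noteq> {} \<and> xs ! i \<inter> (verts G - X_of Y) \<noteq> {}}"
      unfolding cut_edges_def
    proof (intro Collect_cong conj_cong HOL.refl)
      fix i assume "i \<in> I"
      then have "xs ! i \<subseteq> verts G" using edge by blast
      then show "(E i \<inter> Y \<noteq> {}) = (xs ! i \<inter> X_of Y \<noteq> {})"
        "(E i - Y \<noteq> {}) = (xs ! i \<inter> (verts G - X_of Y) \<noteq> {})"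
        by (auto simp: E_def X_of_def)
    qed
    then have "card (cut_edges I E Y)
      = size {#e \<in># E'. e \<inter> X_of Y \<noteq> {} \<and> e \<inter> (verts G - X_of Y) \<noteq> {}#}"
      using card_nth_eq_size_filter_mset[of xs
          "\<lambda>e. e \<inter> X_of Y \<noteq> {} \<and> e \<inter> (verts G - X_of Y) \<noteq> {}"]
      unfolding I_def xs by (rule trans[OF arg_cong])
    also have "\<dots> = size (boundary G (X_of Y))"
      using size_boundary_kept[OF F uncut_vimage[OF wf F, of Y]]
      by (simp add: kept X_of_def \<pi>_def)
    finally show ?thesis .
  qed
  have "card I \<le> 60 * card (\<pi> ` T) * c ^ 3"
  proof (rule card_essential_hyperedges_le)
    show "finite (\<pi> ` verts G)" "finite I" "\<pi> ` T \<subseteq> \<pi> ` verts G" "0 < c"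
      using finV T c by (auto simp: I_def)
    fix i assume i: "i \<in> I"
    show "E i \<subseteq> \<pi> ` verts G \<and> E i \<noteq> {}"
      using edge[OF i] by (auto simp: E_def)
    let ?f = "xs ! i"
    define E'' where "E'' = E' - {#?f#}"
    have "size E'' < size E'" using xsE'[OF i] by (simp add: E''_def size_Diff1_less)
    moreover have E'': "E'' \<subseteq># hedges G" using E' subset_mset.order_trans[OF diff_subset_eq_self]
      unfolding E''_def by blast
    moreover have F'': "hedges G - E'' = add_mset ?f F"
    proof (rule multiset_eqI)
      fix e
      have "count E' e \<le> count (hedges G) e" using E' by (simp add: subseteq_mset_def)
      moreover have "0 < count E' ?f" using xsE'[OF i] by simp
      ultimately show "count (hedges G - E'') e = count (add_mset ?f F) e"
        by (auto simp: E''_def F_def)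
    qed
    ultimately have "\<not> preserves_cuts G T c (add_mset ?f F)"
      using minimal[of E''] by simp
    then obtain T1 T2 X where "T1 \<subseteq> T \<and> T2 \<subseteq> T \<and> T1 \<inter> T2 = {}" "X \<in> cuts G T1 T2"
      "size (boundary G X) < c" "\<not> (\<exists>X'\<in>cuts G T1 T2. uncut (add_mset ?f F) X' \<and>
        size (boundary G X') \<le> size (boundary G X))"
      unfolding preserves_cuts_def by (auto simp only: not_all not_imp Ball_def)
    then have TX: "T1 \<subseteq> T" "T2 \<subseteq> T" "T1 \<inter> T2 = {}" "X \<in> cuts G T1 T2"
      "size (boundary G X) < c"
      and no: "\<And>X'. X' \<in> cuts G T1 T2 \<Longrightarrow> uncut (add_mset ?f F) X' \<Longrightarrow>
        \<not> size (boundary G X') \<le> size (boundary G X)"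
      by simp_all
    \<comment> \<open>\<open>X\<close> itself may cut hyperedges of \<open>F\<close> and then is no
      cut of the contraction; preservation replaces it by \<open>X1\<close>, which is uncut and no
      larger.\<close>
    obtain X1 where X1: "X1 \<in> cuts G T1 T2" "uncut F X1" "size (boundary G X1) \<le> size (boundary G X)"
      using pres[unfolded preserves_cuts_def F_def[symmetric], rule_format, OF TX] by blast
    have X1': "X1 \<subseteq> verts G" "T1 \<subseteq> X1" "T2 \<inter> X1 = {}" using X1(1) by (auto simp: cuts_def)
    have X_of_X1: "X_of (\<pi> ` X1) = X1"
      unfolding X_of_def \<pi>_def by (rule uncut_eq_vimage[OF X1(2) X1'(1)])
    have Y1: "\<pi> ` X1 \<subseteq> \<pi> ` verts G" using X1' by auto
    show "\<exists>Y\<subseteq>\<pi> ` verts G. card (cut_edges I E Y) < c \<and>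
      (\<forall>Y'\<subseteq>\<pi> ` verts G. Y' \<inter> \<pi> ` T = Y \<inter> \<pi> ` T \<longrightarrow>
        card (cut_edges I E Y') \<le> card (cut_edges I E Y) \<longrightarrow> i \<in> cut_edges I E Y')"
    proof (intro exI[of _ "\<pi> ` X1"] conjI allI impI)
      show "card (cut_edges I E (\<pi> ` X1)) < c"
        using card_cut[OF Y1] X_of_X1 X1(3) TX(5) by simp
      fix Y' assume Y': "Y' \<subseteq> \<pi> ` verts G" "Y' \<inter> \<pi> ` T = \<pi> ` X1 \<inter> \<pi> ` T"
        "card (cut_edges I E Y') \<le> card (cut_edges I E (\<pi> ` X1))"
      have le: "size (boundary G (X_of Y')) \<le> size (boundary G X)"
        using card_cut[OF Y'(1)] card_cut[OF Y1] X_of_X1 Y'(3) X1(3) by simp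
      \<comment> \<open>\<open>Y'\<close> and the image of \<open>X1\<close> agree on the images of
        the terminals, so the preimage of \<open>Y'\<close> again separates \<open>T1\<close> from
        \<open>T2\<close>.\<close>
      have trace: "t \<in> X_of Y' \<longleftrightarrow> t \<in> X1" if "t \<in> T" for t
      proof -
        have "t \<in> X_of Y' \<longleftrightarrow> \<pi> t \<in> Y' \<inter> \<pi> ` T" using that T by (auto simp: X_of_def)
        also have "\<dots> \<longleftrightarrow> t \<in> X_of (\<pi> ` X1)" unfolding Y'(2) using that T by (auto simp: X_of_def)
        finally show ?thesis unfolding X_of_X1 .
      qed
      have "X_of Y' \<in> cuts G T1 T2"
        unfolding cuts_def
      proof (intro CollectI conjI subsetI)
        show "v \<in> verts G" if "v \<in> X_of Y'" for v using that by (simp add: X_of_def)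
        show "t \<in> X_of Y'" if "t \<in> T1" for t using that trace[of t] TX(1) X1'(2) by auto
        show "t \<in> verts G - X_of Y'" if "t \<in> T2" for t
          using that trace[of t] TX(2) T X1'(3) by auto
      qed
      with no le have "\<not> uncut (add_mset ?f F) (X_of Y')" by blast
      moreover have "uncut F (X_of Y')"
        unfolding X_of_def \<pi>_def by (rule uncut_vimage[OF wf F])
      ultimately have "?f \<inter> X_of Y' \<noteq> {}" "\<not> ?f \<subseteq> X_of Y'"
        by (auto simp: uncut_def)
      then show "i \<in> cut_edges I E Y'"
        using i edge[OF i] by (auto simp: cut_edges_def E_def X_of_def)
    qed (use Y1 in auto)
  qed
  also have "card (\<pi> ` T) \<le> card T"
    using T finV by (intro card_image_le) (auto intro: finite_subset)
  then have "60 * card (\<pi> ` T) * c ^ 3 \<le> 60 * card T * c ^ 3" by simp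
  finally show ?thesis using xs by (auto simp: I_def)
qed

text \<open>A feasible \<open>E'\<close> of least size works. Keeping all hyperedges is feasible,
  since then nothing is contracted and every set is uncut.\<close>

lemma small_preserving_edges_exist:
  assumes "wf_hypergraph G" "T \<subseteq> verts G" "0 < c"
  shows "\<exists>E'. E' \<subseteq># hedges G \<and> size E' \<le> 60 * card T * c ^ 3 \<and>
    preserves_cuts G T c (hedges G - E')"
proof -
  let ?P = "\<lambda>E'. E' \<subseteq># hedges G \<and> preserves_cuts G T c (hedges G - E')"
  have "?P (hedges G)" by (auto simp: preserves_cuts_def uncut_def)
  from ex_has_least_nat[of ?P, OF this, of size] obtain E' where
    E': "?P E'" "\<And>E''. ?P E'' \<Longrightarrow> size E' \<le> size E''" by blast
  then have "size E' \<le> 60 * card T * c ^ 3"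
    by (intro small_minimal_kept_edges[OF assms]) (auto simp: not_less[symmetric])
  with E' show ?thesis by blast
qed

text \<open>Keeping more hyperedges harms neither the cut condition nor injectivity, so a preserving
  set of size at most \<open>60 * card T * c ^ 3\<close> can be enlarged by any \<open>S\<close>
  that keeps the terminals distinct. \<open>D\<close> fixes in advance how large \<open>S\<close>
  may be, whence the constant \<open>60 + D\<close>.\<close>

theorem theorem8:
  fixes D :: nat
  shows "\<exists>C :: nat. \<forall>(G :: 'a hypergraph) T c.
    wf_hypergraph G \<longrightarrow> T \<subseteq> verts G \<longrightarrow> 0 < c \<longrightarrow>
    (\<exists>E'. E' \<subseteq># hedges G \<and> size E' \<le> C * card T * c ^ 3 \<and>
      contraction_sparsifier (contraction_map (hedges G - E')) T c G
        (contract G (hedges G - E')) \<and>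
      ((\<exists>S. S \<subseteq># hedges G \<and> size S \<le> D * card T * c ^ 3 \<and>
          inj_on (contraction_map (hedges G - S)) T) \<longrightarrow>
        terminal_equivalent (contraction_map (hedges G - E')) T c G
          (contract G (hedges G - E'))))"
proof (intro exI[of _ "60 + D"] allI impI)
  fix G :: "'a hypergraph" and T and c :: nat
  assume wf: "wf_hypergraph G" and T: "T \<subseteq> verts G" and c: "0 < c"
  obtain E0 where E0: "E0 \<subseteq># hedges G" "size E0 \<le> 60 * card T * c ^ 3"
    "preserves_cuts G T c (hedges G - E0)"
    using small_preserving_edges_exist[OF wf T c] by blast
  have sparsifier: "contraction_sparsifier (contraction_map (hedges G - E')) T c G
        (contract G (hedges G - E'))" if "E0 \<subseteq># E'" for E'
  proof -
    have "hedges G - E' \<subseteq># hedges G - E0"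
      using that by (simp add: subseteq_mset_def diff_le_mono2)
    then have "preserves_cuts G T c (hedges G - E')" using E0(3) by (rule preserves_cuts_mono)
    then show ?thesis
      using contraction_sparsifier_iff_preserves_cuts[OF wf T diff_subset_eq_self] by blast
  qed
  show "\<exists>E'. E' \<subseteq># hedges G \<and> size E' \<le> (60 + D) * card T * c ^ 3 \<and>
      contraction_sparsifier (contraction_map (hedges G - E')) T c G
        (contract G (hedges G - E')) \<and>
      ((\<exists>S. S \<subseteq># hedges G \<and> size S \<le> D * card T * c ^ 3 \<and>
          inj_on (contraction_map (hedges G - S)) T) \<longrightarrow>
        terminal_equivalent (contraction_map (hedges G - E')) T c G
          (contract G (hedges G - E')))"
  proof (cases "\<exists>S. S \<subseteq># hedges G \<and> size S \<le> D * card T * c ^ 3 \<and>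
          inj_on (contraction_map (hedges G - S)) T")
    case False
    have "size E0 \<le> (60 + D) * card T * c ^ 3"
      using E0(2) by (simp add: algebra_simps)
    then show ?thesis using E0(1) sparsifier[of E0] False by blast
  next
    case True
    then obtain S where S: "S \<subseteq># hedges G" "size S \<le> D * card T * c ^ 3"
      "inj_on (contraction_map (hedges G - S)) T" by blast
    \<comment> \<open>This union takes maximal multiplicities and so stays within
      \<open>hedges G\<close>, which the sum might exceed.\<close>
    define E' where "E' = E0 \<union># S"
    have sub: "E0 \<subseteq># E'" "S \<subseteq># E'" "E' \<subseteq># hedges G"
      using E0(1) S(1) by (simp_all add: E'_def)
    have "size E' \<le> size (E0 + S)"
      by (rule size_mset_mono) (simp add: E'_def subseteq_mset_def)
    then have size: "size E' \<le> (60 + D) * card T * c ^ 3"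
      using E0(2) S(2) by (simp add: algebra_simps)
    have "hedges G - E' \<subseteq># hedges G - S"
      using sub(2) by (simp add: subseteq_mset_def diff_le_mono2)
    from contraction_map_eq_mono[OF this] S(3)
    have "inj_on (contraction_map (hedges G - E')) T"
      unfolding inj_on_def by blast
    then show ?thesis
      using sub(3) size sparsifier[OF sub(1)] by (auto simp: terminal_equivalent_def)
  qed
qed

end
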